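(* Let $S\subset\mathbb H^3$ be a complete surface with a connected cone-like end $C\subset\partial_\infty\mathbb H^3$. If $K$ denotes the extrinsic curvature of $S$ and $dS$ is the (hyperbolic) area element, then $$\int_S K\,dS$$ is absolutely convergent.
   Context: The Poincaré half-space model is $\mathbb H^3=\{x\in\mathbb R^3: x_3>0\}$ with metric $x_3^{-2}(dx_1^2+dx_2^2+dx_3^2)$; $\partial_\infty\mathbb H^3$ is identified with $\mathbb R^2=\{x_3=0\}$ (together with $\infty$). The extrinsic curvature $K$ is the product of the principal curvatures with respect to the hyperbolic metric. Cone-like ends: let $f\colon S\to\mathbb H^3$ be an immersion of a $\mathcal C^2$ surface $S$. $S$ has cone-like ends if (i) $S$ is the interior of a compact surface with boundary $\overline S$, and in the half-space model $f$ extends to a $\mathcal C^2$ immersion $f\colon\overline S\to\mathbb R^3$; (ii) $C=f(\partial\overline S)$ is a collection of simple closed curves contained in the boundary plane $\{x_3=0\}$; (iii) $f(\overline S)$ is orthogonal (in the Euclidean sense) to $\partial_\infty\mathbb H^3$ along $C$. The cone-like end is connected if $C$ is a single simple closed curve. *)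

theory Defs
  imports "HOL-Analysis.Analysis"
begin

section \<open>Maps of class \<open>C\<^sup>2\<close>\<close>

text \<open>On a set that is not open (here: relatively open subsets of a closed half-plane), being of
  class \<open>C\<^sup>2\<close> means extending, locally around each point, to a \<open>C\<^sup>2\<close> map on an open set.\<close>

definition C2_on :: "'a::real_normed_vector set \<Rightarrow> ('a \<Rightarrow> 'b::real_normed_vector) \<Rightarrow> bool" where
  "C2_on T g \<longleftrightarrow> (\<forall>x\<in>T. \<exists>U h. \<exists>h' :: 'a \<Rightarrow> 'a \<Rightarrow>\<^sub>L 'b. \<exists>h'' :: 'a \<Rightarrow> 'a \<Rightarrow>\<^sub>L 'a \<Rightarrow>\<^sub>L 'b.
      open U \<and> x \<in> U \<and>
      (\<forall>z\<in>U. (h has_derivative blinfun_apply (h' z)) (at z)) \<and>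
      (\<forall>z\<in>U. (h' has_derivative blinfun_apply (h'' z)) (at z)) \<and>
      continuous_on U h'' \<and>
      (\<forall>z\<in>T \<inter> U. g z = h z))"


section \<open>Abstract \<open>C\<^sup>2\<close> surfaces with boundary\<close>

text \<open>A chart is a pair of its domain and its coordinate map; only the values of the map on the
  domain matter. An atlas is a set of charts on a topology \<open>X\<close>.\<close>

type_synonym 'a chart = "'a set \<times> ('a \<Rightarrow> real^2)"

definition half_plane :: "(real^2) set" where
  "half_plane = {y. 0 \<le> y$2}"

definition is_chart :: "'a topology \<Rightarrow> 'a chart \<Rightarrow> bool" where
  "is_chart X = (\<lambda>(U, \<phi>). openin X U \<and> openin (top_of_set half_plane) (\<phi> ` U) \<and>
      homeomorphic_map (subtopology X U) (top_of_set (\<phi> ` U)) \<phi>)"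

definition C2_surface_with_boundary :: "'a topology \<Rightarrow> 'a chart set \<Rightarrow> bool" where
  "C2_surface_with_boundary X A \<longleftrightarrow>
     Hausdorff_space X \<and> second_countable X \<and>
     (\<forall>c\<in>A. is_chart X c) \<and> (\<Union>c\<in>A. fst c) = topspace X \<and>
     (\<forall>(U, \<phi>)\<in>A. \<forall>(V, \<psi>)\<in>A. C2_on (\<phi> ` (U \<inter> V)) (\<psi> \<circ> inv_into U \<phi>))"

definition surface_boundary :: "'a topology \<Rightarrow> 'a chart set \<Rightarrow> 'a set" where
  "surface_boundary X A = {p \<in> topspace X. \<exists>(U, \<phi>)\<in>A. p \<in> U \<and> \<phi> p $ 2 = 0}"

definition surface_interior :: "'a topology \<Rightarrow> 'a chart set \<Rightarrow> 'a set" where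
  "surface_interior X A = topspace X - surface_boundary X A"

definition local_rep :: "('a \<Rightarrow> real^3) \<Rightarrow> 'a chart \<Rightarrow> real^2 \<Rightarrow> real^3" where
  "local_rep f = (\<lambda>(U, \<phi>). f \<circ> inv_into U \<phi>)"

text \<open>The derivative within a relatively open subset of the half-plane is unique, also at boundary
  points.\<close>

definition C2_immersion :: "'a chart set \<Rightarrow> ('a \<Rightarrow> real^3) \<Rightarrow> bool" where
  "C2_immersion A f \<longleftrightarrow> (\<forall>(U, \<phi>)\<in>A. C2_on (\<phi> ` U) (local_rep f (U, \<phi>)) \<and>
     (\<forall>y\<in>\<phi> ` U. \<exists>D. (local_rep f (U, \<phi>) has_derivative D) (at y within \<phi> ` U) \<and> inj D))"


section \<open>Riemannian metrics on open subsets of \<open>\<real>\<^sup>3\<close>\<close>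

type_synonym metric3 = "real^3 \<Rightarrow> real^3^3"

definition metric_inner :: "metric3 \<Rightarrow> real^3 \<Rightarrow> real^3 \<Rightarrow> real^3 \<Rightarrow> real" where
  "metric_inner G x u v = u \<bullet> (G x *v v)"

definition partial :: "3 \<Rightarrow> (real^3 \<Rightarrow> real) \<Rightarrow> real^3 \<Rightarrow> real" where
  "partial i h x = frechet_derivative h (at x) (axis i 1)"

text \<open>\<open>christoffel G x k i j\<close> is the Christoffel symbol with upper index \<open>k\<close> and lower indices
  \<open>i\<close>, \<open>j\<close>.\<close>

definition christoffel :: "metric3 \<Rightarrow> real^3 \<Rightarrow> 3 \<Rightarrow> 3 \<Rightarrow> 3 \<Rightarrow> real" where
  "christoffel G x k i j = (\<Sum>l\<in>UNIV. matrix_inv (G x) $ k $ l *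
     (partial i (\<lambda>z. G z $ j $ l) x + partial j (\<lambda>z. G z $ i $ l) x
       - partial l (\<lambda>z. G z $ i $ j) x) / 2)"

definition hyperbolic_space :: "(real^3) set" where
  "hyperbolic_space = {x. 0 < x$3}"

definition hyperbolic_metric :: metric3 where
  "hyperbolic_metric x = (1 / (x$3)\<^sup>2) *\<^sub>R mat 1"


section \<open>Local geometry of a parametrized surface \<open>F\<close> in a Riemannian metric \<open>G\<close>\<close>

definition D1 :: "(real^2 \<Rightarrow> real^3) \<Rightarrow> real^2 \<Rightarrow> real^2 \<Rightarrow> real^3" where
  "D1 F y v = frechet_derivative F (at y) v"

definition D2 :: "(real^2 \<Rightarrow> real^3) \<Rightarrow> real^2 \<Rightarrow> real^2 \<Rightarrow> real^2 \<Rightarrow> real^3" where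
  "D2 F y u v = frechet_derivative (\<lambda>z. D1 F z v) (at y) u"

definition first_form :: "metric3 \<Rightarrow> (real^2 \<Rightarrow> real^3) \<Rightarrow> real^2 \<Rightarrow> real^2 \<Rightarrow> real^2 \<Rightarrow> real" where
  "first_form G F y u v = metric_inner G (F y) (D1 F y u) (D1 F y v)"

text \<open>The Levi-Civita derivative, in the direction \<open>u\<close>, of the vector field along \<open>F\<close> that is the
  image under the differential of \<open>F\<close> of the constant field \<open>v\<close>.\<close>

definition covariant_D :: "metric3 \<Rightarrow> (real^2 \<Rightarrow> real^3) \<Rightarrow> real^2 \<Rightarrow> real^2 \<Rightarrow> real^2 \<Rightarrow> real^3" where
  "covariant_D G F y u v = D2 F y u v +
     (\<chi> k. \<Sum>i\<in>UNIV. \<Sum>j\<in>UNIV. christoffel G (F y) k i j * D1 F y u $ i * D1 F y v $ j)"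

definition unit_normal :: "metric3 \<Rightarrow> (real^2 \<Rightarrow> real^3) \<Rightarrow> real^2 \<Rightarrow> real^3 \<Rightarrow> bool" where
  "unit_normal G F y N \<longleftrightarrow>
     (\<forall>v. metric_inner G (F y) (D1 F y v) N = 0) \<and> metric_inner G (F y) N N = 1"

definition second_form ::
  "metric3 \<Rightarrow> (real^2 \<Rightarrow> real^3) \<Rightarrow> real^2 \<Rightarrow> real^3 \<Rightarrow> real^2 \<Rightarrow> real^2 \<Rightarrow> real" where
  "second_form G F y N u v = metric_inner G (F y) (covariant_D G F y u v) N"

text \<open>\<open>v\<close> is an eigenvector, with eigenvalue \<open>k\<close>, of the shape operator, which is the endomorphism
  representing the second fundamental form with respect to the first.\<close>

definition principal_direction ::
  "metric3 \<Rightarrow> (real^2 \<Rightarrow> real^3) \<Rightarrow> real^2 \<Rightarrow> real^3 \<Rightarrow> real \<Rightarrow> real^2 \<Rightarrow> bool" where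
  "principal_direction G F y N k v \<longleftrightarrow>
     v \<noteq> 0 \<and> (\<forall>w. second_form G F y N v w = k * first_form G F y v w)"

text \<open>Principal curvatures are counted with multiplicity by means of a basis of principal
  directions. Replacing \<open>N\<close> by \<open>-N\<close> changes the sign of both, so the product is independent of
  the choice of unit normal.\<close>

definition principal_curvatures ::
  "metric3 \<Rightarrow> (real^2 \<Rightarrow> real^3) \<Rightarrow> real^2 \<Rightarrow> real^3 \<Rightarrow> real \<Rightarrow> real \<Rightarrow> bool" where
  "principal_curvatures G F y N k\<^sub>1 k\<^sub>2 \<longleftrightarrow>
     (\<exists>v\<^sub>1 v\<^sub>2. v\<^sub>1 \<noteq> v\<^sub>2 \<and> independent {v\<^sub>1, v\<^sub>2} \<and>
        principal_direction G F y N k\<^sub>1 v\<^sub>1 \<and> principal_direction G F y N k\<^sub>2 v\<^sub>2)"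

definition area_density :: "metric3 \<Rightarrow> (real^2 \<Rightarrow> real^3) \<Rightarrow> real^2 \<Rightarrow> real" where
  "area_density G F y =
     sqrt (det ((\<chi> i j. first_form G F y (axis i 1) (axis j 1)) :: real^2^2))"


section \<open>Geometry of an immersed surface in a Riemannian metric \<open>G\<close>\<close>

text \<open>The notions of this section concern the interior of the surface, so that the derivatives in a
  chart are taken at interior points of the chart image.\<close>

definition extrinsic_curvature :: "metric3 \<Rightarrow> 'a chart set \<Rightarrow> ('a \<Rightarrow> real^3) \<Rightarrow> 'a \<Rightarrow> real" where
  "extrinsic_curvature G A f p = (THE K. \<exists>(U, \<phi>)\<in>A. \<exists>N k\<^sub>1 k\<^sub>2. p \<in> U \<and>
     unit_normal G (local_rep f (U, \<phi>)) (\<phi> p) N \<and>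
     principal_curvatures G (local_rep f (U, \<phi>)) (\<phi> p) N k\<^sub>1 k\<^sub>2 \<and> K = k\<^sub>1 * k\<^sub>2)"

text \<open>The Riemannian area measure of the interior is the Borel measure given in every chart by the
  area density; these conditions determine it uniquely.\<close>

definition is_area_measure ::
  "metric3 \<Rightarrow> 'a topology \<Rightarrow> 'a chart set \<Rightarrow> ('a \<Rightarrow> real^3) \<Rightarrow> 'a measure \<Rightarrow> bool" where
  "is_area_measure G X A f \<mu> \<longleftrightarrow>
     space \<mu> = surface_interior X A \<and>
     sets \<mu> = sigma_sets (surface_interior X A)
                {V. openin (subtopology X (surface_interior X A)) V} \<and>
     (\<forall>(U, \<phi>)\<in>A. \<forall>B\<in>sets \<mu>. B \<subseteq> U \<longrightarrow>
        emeasure \<mu> B = (\<integral>\<^sup>+y\<in>\<phi> ` B. ennreal (area_density G (local_rep f (U, \<phi>)) y) \<partial>lborel))"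

definition piecewise_C1_path :: "'a topology \<Rightarrow> 'a chart set \<Rightarrow> (real \<Rightarrow> 'a) \<Rightarrow> bool" where
  "piecewise_C1_path X A \<gamma> \<longleftrightarrow> pathin (subtopology X (surface_interior X A)) \<gamma> \<and>
     (\<exists>E. finite E \<and> (\<forall>(U, \<phi>)\<in>A.
        (\<phi> \<circ> \<gamma>) C1_differentiable_on {t \<in> {0..1} - E. \<gamma> t \<in> U}))"

definition path_length :: "metric3 \<Rightarrow> ('a \<Rightarrow> real^3) \<Rightarrow> (real \<Rightarrow> 'a) \<Rightarrow> ennreal" where
  "path_length G f \<gamma> = (\<integral>\<^sup>+t\<in>{0..1}. ennreal (sqrt (metric_inner G (f (\<gamma> t))
      (vector_derivative (f \<circ> \<gamma>) (at t)) (vector_derivative (f \<circ> \<gamma>) (at t)))) \<partial>lborel)"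

definition riemannian_dist ::
  "metric3 \<Rightarrow> 'a topology \<Rightarrow> 'a chart set \<Rightarrow> ('a \<Rightarrow> real^3) \<Rightarrow> 'a \<Rightarrow> 'a \<Rightarrow> ennreal" where
  "riemannian_dist G X A f p q =
     (INF \<gamma> \<in> {\<gamma>. piecewise_C1_path X A \<gamma> \<and> \<gamma> 0 = p \<and> \<gamma> 1 = q}. path_length G f \<gamma>)"

definition complete_surface ::
  "metric3 \<Rightarrow> 'a topology \<Rightarrow> 'a chart set \<Rightarrow> ('a \<Rightarrow> real^3) \<Rightarrow> bool" where
  "complete_surface G X A f \<longleftrightarrow>
     (\<forall>\<sigma> :: nat \<Rightarrow> 'a. range \<sigma> \<subseteq> surface_interior X A \<and>
        (\<forall>e>0. \<exists>M. \<forall>m\<ge>M. \<forall>n\<ge>M. riemannian_dist G X A f (\<sigma> m) (\<sigma> n) < e) \<longrightarrow>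
        (\<exists>p\<in>surface_interior X A. (\<lambda>n. riemannian_dist G X A f (\<sigma> n) p) \<longlonglongrightarrow> 0))"


section \<open>Cone-like ends\<close>

definition simple_closed_curve :: "(real^3) set \<Rightarrow> bool" where
  "simple_closed_curve C \<longleftrightarrow>
     (\<exists>g. simple_path g \<and> pathfinish g = pathstart g \<and> path_image g = C)"

text \<open>Two planes are orthogonal iff their normals are; \<open>axis 3 1\<close> is normal to the ideal boundary
  plane.\<close>

definition orthogonal_along_boundary ::
  "'a topology \<Rightarrow> 'a chart set \<Rightarrow> ('a \<Rightarrow> real^3) \<Rightarrow> bool" where
  "orthogonal_along_boundary X A f \<longleftrightarrow>
     (\<forall>(U, \<phi>)\<in>A. \<forall>p\<in>U \<inter> surface_boundary X A. \<forall>D n.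
        (local_rep f (U, \<phi>) has_derivative D) (at (\<phi> p) within \<phi> ` U) \<longrightarrow>
        (\<forall>v. n \<bullet> D v = 0) \<longrightarrow> n \<bullet> axis 3 1 = 0)"

text \<open>\<open>X\<close> with atlas \<open>A\<close> is the compact surface with boundary, \<open>f\<close> the extended immersion; the
  surface in hyperbolic space is the restriction of \<open>f\<close> to the interior.\<close>

definition cone_like_ends :: "'a topology \<Rightarrow> 'a chart set \<Rightarrow> ('a \<Rightarrow> real^3) \<Rightarrow> bool" where
  "cone_like_ends X A f \<longleftrightarrow>
     C2_surface_with_boundary X A \<and> compact_space X \<and> C2_immersion A f \<and>
     f ` surface_interior X A \<subseteq> hyperbolic_space \<and>
     (\<exists>\<C>. (\<forall>C\<in>\<C>. simple_closed_curve C) \<and> f ` surface_boundary X A = \<Union>\<C>) \<and>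
     f ` surface_boundary X A \<subseteq> {x. x$3 = 0} \<and>
     orthogonal_along_boundary X A f"

definition connected_cone_like_end ::
  "'a topology \<Rightarrow> 'a chart set \<Rightarrow> ('a \<Rightarrow> real^3) \<Rightarrow> (real^3) set \<Rightarrow> bool" where
  "connected_cone_like_end X A f C \<longleftrightarrow>
     cone_like_ends X A f \<and> C = f ` surface_boundary X A \<and> simple_closed_curve C"

end

theory Submission
  imports Defs
begin

text \<open>In a chart \<open>h\<close> let \<open>\<nu>\<close> be the cross product of the two partial derivatives, \<open>g\<close> the Euclidean first
  fundamental form, \<open>b\<close> the inner products of the second partial derivatives with \<open>\<nu>\<close>, \<open>x\<close> the height
  \<open>h $ 3\<close> and \<open>m = \<nu> $ 3\<close>. Conformality of the hyperbolic metric gives \<open>K = det (x b + m g) / \<bar>\<nu>\<bar>^4\<close> and the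
  area density \<open>\<bar>\<nu>\<bar> / x^2\<close>. At the ideal boundary \<open>x\<close> vanishes with non-zero normal derivative, while \<open>m\<close>
  is of class \<open>C\<^sup>1\<close> and vanishes by orthogonality; hence \<open>m = O(x)\<close> and \<open>K = O(x^2)\<close>. So \<open>K dS\<close> has a
  density that is locally bounded up to the boundary, and compactness concludes.\<close>

section \<open>Maps of class \<open>C\<^sup>2\<close>\<close>

definition C2_derivs ::
  "'a::real_normed_vector set \<Rightarrow> ('a \<Rightarrow> 'b::real_normed_vector) \<Rightarrow> ('a \<Rightarrow> 'a \<Rightarrow>\<^sub>L 'b) \<Rightarrow>
    ('a \<Rightarrow> 'a \<Rightarrow>\<^sub>L 'a \<Rightarrow>\<^sub>L 'b) \<Rightarrow> bool" where
  "C2_derivs U h h' h'' \<longleftrightarrow> open U \<and>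
      (\<forall>z\<in>U. (h has_derivative blinfun_apply (h' z)) (at z)) \<and>
      (\<forall>z\<in>U. (h' has_derivative blinfun_apply (h'' z)) (at z)) \<and>
      continuous_on U h''"

lemma C2_derivsD:
  assumes "C2_derivs U h h' h''"
  shows "open U" "\<And>z. z \<in> U \<Longrightarrow> (h has_derivative blinfun_apply (h' z)) (at z)"
    "\<And>z. z \<in> U \<Longrightarrow> (h' has_derivative blinfun_apply (h'' z)) (at z)"
    "continuous_on U h''"
  using assms by (auto simp: C2_derivs_def)

lemma C2_derivs_continuous:
  assumes "C2_derivs U h h' h''"
  shows "continuous_on U h" "continuous_on U h'"
  using C2_derivsD[OF assms]
  by (meson continuous_at_imp_continuous_on has_derivative_continuous)+

lemma C2_derivs_subset:
  assumes "C2_derivs U h h' h''" "open V" "V \<subseteq> U"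
  shows "C2_derivs V h h' h''"
  using assms continuous_on_subset unfolding C2_derivs_def by blast

lemma second_difference_mean_value:
  fixes h :: "'a::real_normed_vector \<Rightarrow> 'b::real_inner"
  assumes C2: "C2_derivs U h h' h''" and s: "0 < s"
    and sub: "\<And>a b. 0 \<le> a \<Longrightarrow> a \<le> s \<Longrightarrow> 0 \<le> b \<Longrightarrow> b \<le> s \<Longrightarrow> y + a *\<^sub>R u + b *\<^sub>R v \<in> U"
  obtains a b where "0 < a" "a < s" "0 < b" "b < s"
    "(h (y + s *\<^sub>R u + s *\<^sub>R v) - h (y + s *\<^sub>R u) - h (y + s *\<^sub>R v) + h y) \<bullet> c
      = s\<^sup>2 * (h'' (y + a *\<^sub>R u + b *\<^sub>R v) v u \<bullet> c)"
proof -
  note d = C2_derivsD[OF C2]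
  define p where "p t = (h (y + t *\<^sub>R u + s *\<^sub>R v) - h (y + t *\<^sub>R u)) \<bullet> c" for t
  define p' where "p' t r = r * ((h' (y + t *\<^sub>R u + s *\<^sub>R v) u - h' (y + t *\<^sub>R u) u) \<bullet> c)" for t r
  have dp: "(p has_derivative p' t) (at t within {0..s})" if t: "0 \<le> t" "t \<le> s" for t
  proof -
    have in1: "y + t *\<^sub>R u + s *\<^sub>R v \<in> U" "y + t *\<^sub>R u \<in> U"
      using sub[of t s] sub[of t 0] t s by auto
    have lin: "((\<lambda>t. y + t *\<^sub>R u + b *\<^sub>R v) has_derivative (\<lambda>r. r *\<^sub>R u)) (at t within {0..s})" for b
      by (auto intro!: derivative_eq_intros)
    have "(p has_derivative (\<lambda>r. (h' (y + t *\<^sub>R u + s *\<^sub>R v) (r *\<^sub>R u) - h' (y + t *\<^sub>R u) (r *\<^sub>R u)) \<bullet> c))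
        (at t within {0..s})"
      unfolding p_def
      using has_derivative_compose[OF lin[of s], of h] has_derivative_compose[OF lin[of 0], of h]
        d(2)[OF in1(1)] d(2)[OF in1(2)]
      by (intro has_derivative_inner_left has_derivative_diff) auto
    moreover have "(\<lambda>r. (h' (y + t *\<^sub>R u + s *\<^sub>R v) (r *\<^sub>R u) - h' (y + t *\<^sub>R u) (r *\<^sub>R u)) \<bullet> c) = p' t"
      by (auto simp: p'_def blinfun.scaleR_right inner_diff_left algebra_simps)
    ultimately show ?thesis by simp
  qed
  obtain a where a: "a \<in> {0<..<s}" "p s - p 0 = p' a (s - 0)"
    using mvt_simple[OF s, of p p'] dp by auto
  define q where "q t = h' (y + a *\<^sub>R u + t *\<^sub>R v) u \<bullet> c" for t
  define q' where "q' t r = r * (h'' (y + a *\<^sub>R u + t *\<^sub>R v) v u \<bullet> c)" for t r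
  have dq: "(q has_derivative q' t) (at t within {0..s})" if t: "0 \<le> t" "t \<le> s" for t
  proof -
    have in1: "y + a *\<^sub>R u + t *\<^sub>R v \<in> U"
      using sub[of a t] t a by auto
    have lin: "((\<lambda>t. y + a *\<^sub>R u + t *\<^sub>R v) has_derivative (\<lambda>r. r *\<^sub>R v)) (at t within {0..s})"
      by (auto intro!: derivative_eq_intros)
    have "((\<lambda>t. h' (y + a *\<^sub>R u + t *\<^sub>R v)) has_derivative (\<lambda>r. h'' (y + a *\<^sub>R u + t *\<^sub>R v) (r *\<^sub>R v)))
        (at t within {0..s})"
      using has_derivative_compose[OF lin, of h'] d(3)[OF in1] by auto
    then have "(q has_derivative (\<lambda>r. h'' (y + a *\<^sub>R u + t *\<^sub>R v) (r *\<^sub>R v) u \<bullet> c)) (at t within {0..s})"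
      unfolding q_def
      by (intro has_derivative_inner_left bounded_linear.has_derivative
          [OF bounded_bilinear.bounded_linear_left[OF bounded_bilinear_blinfun_apply]])
    moreover have "(\<lambda>r. h'' (y + a *\<^sub>R u + t *\<^sub>R v) (r *\<^sub>R v) u \<bullet> c) = q' t"
      by (auto simp: q'_def blinfun.scaleR_right blinfun.scaleR_left)
    ultimately show ?thesis by simp
  qed
  obtain b where b: "b \<in> {0<..<s}" "q s - q 0 = q' b (s - 0)"
    using mvt_simple[OF s, of q q'] dq by auto
  have "p s - p 0 = s * (q s - q 0)"
    using a(2) by (simp add: p'_def q_def inner_diff_left)
  then have "(h (y + s *\<^sub>R u + s *\<^sub>R v) - h (y + s *\<^sub>R u) - h (y + s *\<^sub>R v) + h y) \<bullet> c
      = s\<^sup>2 * (h'' (y + a *\<^sub>R u + b *\<^sub>R v) v u \<bullet> c)"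
    using b(2) by (simp add: p_def q'_def inner_diff_left inner_add_left power2_eq_square)
  then show ?thesis using that a b by auto
qed

lemma C2_second_derivative_symmetric:
  fixes h :: "'a::real_normed_vector \<Rightarrow> 'b::real_inner"
  assumes C2: "C2_derivs U h h' h''" and y: "y \<in> U"
  shows "h'' y u v = h'' y v u"
proof -
  note d = C2_derivsD[OF C2]
  have "(h'' y u v - h'' y v u) \<bullet> c = 0" for c
  proof (rule ccontr)
    let ?D = "(h'' y u v - h'' y v u) \<bullet> c"
    assume D: "?D \<noteq> 0"
    define G where "G z = (h'' z v u \<bullet> c, h'' z u v \<bullet> c)" for z
    have "continuous_on U G"
      unfolding G_def by (intro continuous_intros d)
    moreover have "0 < \<bar>?D\<bar> / 2" using D by simp
    ultimately obtain e where e: "e > 0" "\<And>z. z \<in> U \<Longrightarrow> dist z y < e \<Longrightarrow> dist (G z) (G y) < \<bar>?D\<bar> / 2"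
      using y unfolding continuous_on_iff by blast
    obtain r where r: "r > 0" "ball y r \<subseteq> U"
      using d(1) y open_contains_ball by blast
    define s where "s = min e r / (2 * (norm u + norm v + 1))"
    have n: "norm u + norm v + 1 > 0" by (simp add: add_nonneg_pos)
    have s: "s > 0" using e r n by (simp add: s_def)
    have near: "dist (y + a *\<^sub>R w + b *\<^sub>R w') y < min e r"
      if "0 \<le> a" "a \<le> s" "0 \<le> b" "b \<le> s" "norm w + norm w' = norm u + norm v" for a b w w'
    proof -
      have "dist (y + a *\<^sub>R w + b *\<^sub>R w') y = norm (a *\<^sub>R w + b *\<^sub>R w')"
        by (simp add: dist_norm)
      also have "\<dots> \<le> a * norm w + b * norm w'"
        using norm_triangle_ineq[of "a *\<^sub>R w" "b *\<^sub>R w'"] that by simp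
      also have "\<dots> \<le> s * norm w + s * norm w'"
        using that by (intro add_mono mult_right_mono) auto
      also have "\<dots> = s * (norm u + norm v)" using that by (metis distrib_left)
      also have "\<dots> \<le> s * (norm u + norm v + 1)" using s by simp
      also have "\<dots> = min e r / 2" unfolding s_def using n by (simp add: field_simps)
      also have "\<dots> < min e r" using e r by (auto simp: min_def)
      finally show ?thesis .
    qed
    have sub: "y + a *\<^sub>R w + b *\<^sub>R w' \<in> U"
      if "0 \<le> a" "a \<le> s" "0 \<le> b" "b \<le> s" "norm w + norm w' = norm u + norm v" for a b w w'
      using near[OF that] r by (auto simp: dist_commute)
    obtain a b where ab: "0 < a" "a < s" "0 < b" "b < s"
      "(h (y + s *\<^sub>R u + s *\<^sub>R v) - h (y + s *\<^sub>R u) - h (y + s *\<^sub>R v) + h y) \<bullet> c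
      = s\<^sup>2 * (h'' (y + a *\<^sub>R u + b *\<^sub>R v) v u \<bullet> c)"
      using second_difference_mean_value[OF C2 s, of y u v c] sub by metis
    obtain a' b' where ab': "0 < a'" "a' < s" "0 < b'" "b' < s"
      "(h (y + s *\<^sub>R v + s *\<^sub>R u) - h (y + s *\<^sub>R v) - h (y + s *\<^sub>R u) + h y) \<bullet> c
      = s\<^sup>2 * (h'' (y + a' *\<^sub>R v + b' *\<^sub>R u) u v \<bullet> c)"
      using second_difference_mean_value[OF C2 s, of y v u c] sub by (metis add.commute)
    let ?z = "y + a *\<^sub>R u + b *\<^sub>R v" and ?z' = "y + a' *\<^sub>R v + b' *\<^sub>R u"
    have swap: "(h (y + s *\<^sub>R v + s *\<^sub>R u) - h (y + s *\<^sub>R v) - h (y + s *\<^sub>R u) + h y)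
        = (h (y + s *\<^sub>R u + s *\<^sub>R v) - h (y + s *\<^sub>R u) - h (y + s *\<^sub>R v) + h y)"
      by (simp add: algebra_simps)
    have "s\<^sup>2 * (h'' ?z v u \<bullet> c) = s\<^sup>2 * (h'' ?z' u v \<bullet> c)"
      using ab(5) ab'(5) unfolding swap by (rule trans[OF sym])
    then have eq: "h'' ?z v u \<bullet> c = h'' ?z' u v \<bullet> c"
      using s by simp
    have "dist (G ?z) (G y) < \<bar>?D\<bar> / 2" "dist (G ?z') (G y) < \<bar>?D\<bar> / 2"
      using e(2)[of ?z] e(2)[of ?z'] sub[of a b u v] sub[of a' b' v u] near[of a b u v] near[of a' b' v u] ab ab'
      by auto
    moreover have "dist (fst (G ?z)) (fst (G y)) \<le> dist (G ?z) (G y)"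
      "dist (snd (G ?z')) (snd (G y)) \<le> dist (G ?z') (G y)"
      by (rule dist_fst_le dist_snd_le)+
    ultimately have "\<bar>h'' ?z v u \<bullet> c - h'' y v u \<bullet> c\<bar> < \<bar>?D\<bar> / 2"
      "\<bar>h'' ?z' u v \<bullet> c - h'' y u v \<bullet> c\<bar> < \<bar>?D\<bar> / 2"
      unfolding G_def fst_conv snd_conv dist_real_def by linarith+
    moreover have "?D = h'' y u v \<bullet> c - h'' y v u \<bullet> c" by (rule inner_diff_left)
    ultimately show False
      using eq by linarith
  qed
  from this[of "h'' y u v - h'' y v u"] show ?thesis by simp
qed

section \<open>Simultaneous diagonalization and cross products\<close>

lemma coupled_eigen_product:
  fixes E F G L M N :: real
  assumes "L * x1 + M * y1 = k1 * (E * x1 + F * y1)" "M * x1 + N * y1 = k1 * (F * x1 + G * y1)"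
    and "L * x2 + M * y2 = k2 * (E * x2 + F * y2)" "M * x2 + N * y2 = k2 * (F * x2 + G * y2)"
    and "x1 * y2 - x2 * y1 \<noteq> 0"
  shows "L * N - M\<^sup>2 = k1 * k2 * (E * G - F\<^sup>2)"
proof -
  have "(L * N - M\<^sup>2) * (x1 * y2 - x2 * y1)
      = (L * x1 + M * y1) * (M * x2 + N * y2) - (M * x1 + N * y1) * (L * x2 + M * y2)"
    by (simp add: algebra_simps power2_eq_square)
  also have "\<dots> = k1 * k2 * (E * G - F\<^sup>2) * (x1 * y2 - x2 * y1)"
    unfolding assms(1-4) by (simp add: algebra_simps power2_eq_square)
  finally show ?thesis using assms(5) by simp
qed

lemma symmetric_eigenbasis:
  fixes a b c :: real
  obtains k1 k2 s1 t1 s2 t2 where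
    "a * s1 + b * t1 = k1 * s1" "b * s1 + c * t1 = k1 * t1"
    "a * s2 + b * t2 = k2 * s2" "b * s2 + c * t2 = k2 * t2"
    "s1 * t2 - s2 * t1 \<noteq> 0"
proof (cases "b = 0")
  case True
  then show ?thesis using that[of 1 0 a 0 1 c] by simp
next
  case False
  define d where "d = (a - c) / 2"
  define r where "r = sqrt (d\<^sup>2 + b\<^sup>2)"
  have c: "c = a - 2 * d" by (simp add: d_def field_simps)
  have r: "r * r = d * d + b * b" "r \<noteq> 0"
    using False by (auto simp: r_def add_nonneg_eq_0_iff simp flip: power2_eq_square)
  show ?thesis
  proof (rule that[of b "r - d" "a - d + r" b "- r - d" "a - d - r"])
    show "a * b + b * (r - d) = (a - d + r) * b" "a * b + b * (- r - d) = (a - d - r) * b"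
      by (simp_all add: algebra_simps)
    show "b * b + c * (r - d) = (a - d + r) * (r - d)" "b * b + c * (- r - d) = (a - d - r) * (- r - d)"
      unfolding c by (simp_all add: algebra_simps r(1))
    have "b * (- r - d) - b * (r - d) = - 2 * (b * r)" by (simp add: algebra_simps)
    then show "b * (- r - d) - b * (r - d) \<noteq> 0" using False r(2) by simp
  qed
qed

text \<open>In the basis \<open>(1/\<surd>E, 0)\<close>, \<open>(-F, E) / \<surd>(E (E G - F\<^sup>2))\<close>, orthonormal for the form with coefficients
  \<open>E\<close>, \<open>F\<close>, \<open>G\<close>, the problem becomes \<open>symmetric_eigenbasis\<close>.\<close>

lemma coupled_eigenbasis:
  fixes E F G L M N :: real
  assumes E: "E > 0" and D: "E * G - F\<^sup>2 > 0"
  obtains k1 k2 x1 y1 x2 y2 where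
    "L * x1 + M * y1 = k1 * (E * x1 + F * y1)" "M * x1 + N * y1 = k1 * (F * x1 + G * y1)"
    "L * x2 + M * y2 = k2 * (E * x2 + F * y2)" "M * x2 + N * y2 = k2 * (F * x2 + G * y2)"
    "x1 * y2 - x2 * y1 \<noteq> 0"
proof -
  define p where "p = sqrt E"
  define q where "q = sqrt (E * G - F\<^sup>2)"
  have p: "p > 0" "p * p = E" using E by (simp_all add: p_def)
  have q: "q > 0" "q * q = E * G - F * F" using D by (simp_all add: q_def power2_eq_square)
  define e1 where "e1 = 1 / p"
  define f1 where "f1 = - F / (p * q)"
  define f2 where "f2 = p / q"
  obtain k1 k2 s1 t1 s2 t2 where *:
    "L * e1 * e1 * s1 + e1 * (L * f1 + M * f2) * t1 = k1 * s1"
    "e1 * (L * f1 + M * f2) * s1 + (L * f1 * f1 + 2 * M * f1 * f2 + N * f2 * f2) * t1 = k1 * t1"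
    "L * e1 * e1 * s2 + e1 * (L * f1 + M * f2) * t2 = k2 * s2"
    "e1 * (L * f1 + M * f2) * s2 + (L * f1 * f1 + 2 * M * f1 * f2 + N * f2 * f2) * t2 = k2 * t2"
    "s1 * t2 - s2 * t1 \<noteq> 0"
    by (rule symmetric_eigenbasis[of "L * e1 * e1" "e1 * (L * f1 + M * f2)"
        "L * f1 * f1 + 2 * M * f1 * f2 + N * f2 * f2"])
  have e1f: "E * f1 + F * f2 = 0"
    unfolding p(2)[symmetric] f1_def f2_def using p(1) q(1) by (simp add: field_simps)
  have "F * f1 + G * f2 = (p * p * G - F * F) / (p * q)"
    unfolding f1_def f2_def using p(1) q(1) by (simp add: diff_divide_distrib)
  also have "\<dots> = q / p"
    unfolding p(2) q(2)[symmetric] using p(1) q(1) by simp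
  finally have ff: "F * f1 + G * f2 = q / p" .
  have key: "L * (e1 * s + f1 * t) + M * (f2 * t) = k * (E * (e1 * s + f1 * t) + F * (f2 * t))
    \<and> M * (e1 * s + f1 * t) + N * (f2 * t) = k * (F * (e1 * s + f1 * t) + G * (f2 * t))"
    if 1: "L * e1 * e1 * s + e1 * (L * f1 + M * f2) * t = k * s"
    and 2: "e1 * (L * f1 + M * f2) * s + (L * f1 * f1 + 2 * M * f1 * f2 + N * f2 * f2) * t = k * t"
    for s t k
  proof -
    define A where "A = L * (e1 * s + f1 * t) + M * (f2 * t) - k * (E * (e1 * s + f1 * t) + F * (f2 * t))"
    define B where "B = M * (e1 * s + f1 * t) + N * (f2 * t) - k * (F * (e1 * s + f1 * t) + G * (f2 * t))"
    have i: "E * e1 * e1 = 1" unfolding p(2)[symmetric] e1_def using p(1) by simp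
    have ii: "E * f1 + F * f2 = 0" by (rule e1f)
    have iii: "f1 * (E * f1 + F * f2) + f2 * (F * f1 + G * f2) = 1"
      using e1f ff p(1) q(1) by (simp add: f2_def)
    have "e1 * A = (L * e1 * e1 * s + e1 * (L * f1 + M * f2) * t) - k * s * (E * e1 * e1) - k * t * e1 * (E * f1 + F * f2)"
      by (simp add: A_def algebra_simps)
    then have "e1 * A = 0" using 1 i ii by simp
    then have A: "A = 0" using p(1) by (simp add: e1_def)
    have "f1 * A + f2 * B = (e1 * (L * f1 + M * f2) * s + (L * f1 * f1 + 2 * M * f1 * f2 + N * f2 * f2) * t)
       - k * s * e1 * (E * f1 + F * f2) - k * t * (f1 * (E * f1 + F * f2) + f2 * (F * f1 + G * f2))"
      by (simp add: A_def B_def algebra_simps)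
    then have "f1 * A + f2 * B = 0" using 2 ii iii by simp
    then have "B = 0" using A p(1) q(1) by (simp add: f2_def)
    then show ?thesis using A by (simp add: A_def B_def)
  qed
  have "(e1 * s1 + f1 * t1) * (f2 * t2) - (e1 * s2 + f1 * t2) * (f2 * t1) = e1 * f2 * (s1 * t2 - s2 * t1)"
    by (simp add: algebra_simps)
  moreover have "e1 * f2 \<noteq> 0" using p(1) q(1) by (simp add: e1_def f2_def)
  ultimately show ?thesis
    using that[of "e1 * s1 + f1 * t1" "f2 * t1" k1 "e1 * s2 + f1 * t2" "f2 * t2" k2]
      key[OF *(1,2)] key[OF *(3,4)] *(5) by simp
qed

lemma cross_product_parallel:
  fixes a b n :: "real^3"
  assumes "a \<bullet> n = 0" "b \<bullet> n = 0" "cross3 a b \<noteq> 0"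
  obtains c where "n = c *\<^sub>R cross3 a b"
proof -
  have "cross3 (cross3 a b) n = 0"
  proof -
    have "cross3 (cross3 a b) n = (a \<bullet> n) *\<^sub>R b - (b \<bullet> n) *\<^sub>R a"
      by (simp add: cross3_simps forall_3)
    then show ?thesis using assms by simp
  qed
  then have "collinear {0, cross3 a b, n}" by (simp add: cross_eq_0)
  then show ?thesis using that assms(3) by (auto simp: collinear_lemma)
qed

lemma gram_det_cross:
  fixes a b :: "real^3"
  shows "(a \<bullet> a) * (b \<bullet> b) - (a \<bullet> b)\<^sup>2 = cross3 a b \<bullet> cross3 a b"
  using norm_cross_dot[of a b] by (simp add: power_mult_distrib power2_norm_eq_inner)

lemma cross_inj_ne_0:
  fixes D :: "real^2 \<Rightarrow> real^3"
  assumes "linear D" "inj D"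
  shows "cross3 (D (axis 1 1)) (D (axis 2 1)) \<noteq> 0"
proof
  assume "cross3 (D (axis 1 1)) (D (axis 2 1)) = 0"
  then have "collinear {0, D (axis 1 1), D (axis 2 1)}" by (simp add: cross_eq_0)
  then consider "D (axis 1 1) = 0" | c where "D (axis 2 1) = c *\<^sub>R D (axis 1 1)"
    unfolding collinear_lemma by (metis scaleR_zero_left)
  then show False
  proof cases
    case 1
    then have "axis 1 1 = (0 :: real^2)" using assms by (metis linear_injective_0)
    then show ?thesis by (simp add: axis_eq_0_iff)
  next
    case (2 c)
    then have "D (axis 2 1) = D (c *\<^sub>R axis 1 1)" using assms by (simp add: linear_cmul)
    then have "(axis 2 1 :: real^2) = c *\<^sub>R axis 1 1" using assms by (meson injD)
    then show ?thesis by (simp add: vec_eq_iff axis_def forall_2)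
  qed
qed

section \<open>The second fundamental form in hyperbolic space\<close>

lemma C2_derivs_D1:
  assumes "C2_derivs U h h' h''" "z \<in> U" "\<And>z. z \<in> U \<Longrightarrow> F z = h z"
  shows "D1 F z = h' z"
proof -
  have "(F has_derivative h' z) (at z)"
    using C2_derivsD(1,2)[OF assms(1)] assms(2,3) has_derivative_transform_within_open by metis
  then show ?thesis
    unfolding D1_def by (metis frechet_derivative_at)
qed

lemma C2_derivs_D2:
  assumes "C2_derivs U h h' h''" "y \<in> U" "\<And>z. z \<in> U \<Longrightarrow> F z = h z"
  shows "D2 F y u v = h'' y u v"
proof -
  have "((\<lambda>z. h' z v) has_derivative (\<lambda>u. h'' y u v)) (at y)"
    using C2_derivsD(3)[OF assms(1,2)]
    by (intro bounded_linear.has_derivative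
        [OF bounded_bilinear.bounded_linear_left[OF bounded_bilinear_blinfun_apply]])
  then have "((\<lambda>z. D1 F z v) has_derivative (\<lambda>u. h'' y u v)) (at y)"
    using C2_derivsD(1)[OF assms(1)] assms(2) C2_derivs_D1[OF assms(1) _ assms(3)]
      has_derivative_transform_within_open by (metis (no_types, lifting))
  then show ?thesis
    unfolding D2_def by (metis frechet_derivative_at)
qed

lemma matrix_vector_mult_scaled_id:
  "((c::real) *\<^sub>R mat 1 :: real^3^3) *v v = c *\<^sub>R v"
  by (simp add: scaleR_matrix_vector_assoc[symmetric])

lemma metric_inner_hyperbolic:
  "metric_inner hyperbolic_metric x u v = (u \<bullet> v) / (x$3)\<^sup>2"
  by (simp add: metric_inner_def hyperbolic_metric_def matrix_vector_mult_scaled_id)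

lemma partial_hyperbolic_metric:
  assumes "x$3 > 0"
  shows "partial l (\<lambda>z. hyperbolic_metric z $ i $ j) x
    = - 2 / (x$3)^3 * (if i = j \<and> l = 3 then 1 else 0)"
proof (cases "i = j")
  case True
  have "((\<lambda>z::real^3. 1 / (z$3)\<^sup>2) has_derivative (\<lambda>v. - 2 / (x$3)^3 * (v$3))) (at x)"
    using assms
    by (auto intro!: derivative_eq_intros bounded_linear.has_derivative[OF bounded_linear_vec_nth]
        simp: fun_eq_iff field_simps power2_eq_square power3_eq_cube)
  then have "frechet_derivative (\<lambda>z::real^3. 1 / (z$3)\<^sup>2) (at x) = (\<lambda>v. - 2 / (x$3)^3 * (v$3))"
    by (metis frechet_derivative_at)
  then show ?thesis using True
    by (simp add: partial_def hyperbolic_metric_def mat_def axis_def)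
next
  case False
  then show ?thesis by (simp add: partial_def hyperbolic_metric_def mat_def)
qed

lemma matrix_inv_hyperbolic_metric:
  assumes "x$3 > 0"
  shows "matrix_inv (hyperbolic_metric x) = (x$3)\<^sup>2 *\<^sub>R mat 1"
proof -
  have inv: "hyperbolic_metric x ** ((x$3)\<^sup>2 *\<^sub>R mat 1) = mat 1"
    "((x$3)\<^sup>2 *\<^sub>R mat 1) ** hyperbolic_metric x = mat 1"
    using assms by (simp_all add: hyperbolic_metric_def vec_eq_iff forall_3 matrix_matrix_mult_def mat_def sum_3)
  then have "hyperbolic_metric x ** matrix_inv (hyperbolic_metric x) = mat 1
      \<and> matrix_inv (hyperbolic_metric x) ** hyperbolic_metric x = mat 1"
    unfolding matrix_inv_def by (intro someI conjI)
  then have "((x$3)\<^sup>2 *\<^sub>R mat 1) ** (hyperbolic_metric x ** matrix_inv (hyperbolic_metric x)) = (x$3)\<^sup>2 *\<^sub>R mat 1"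
    by (simp only: matrix_mul_rid)
  then show ?thesis
    unfolding matrix_mul_assoc inv(2) by (simp only: matrix_mul_lid)
qed

lemma christoffel_hyperbolic:
  assumes "x$3 > 0"
  shows "christoffel hyperbolic_metric x k i j
    = - ((if j = k \<and> i = 3 then 1 else 0) + (if i = k \<and> j = 3 then 1 else 0)
         - (if i = j \<and> k = 3 then 1 else 0)) / x$3"
proof -
  have "christoffel hyperbolic_metric x k i j
    = (x$3)\<^sup>2 * (partial i (\<lambda>z. hyperbolic_metric z $ j $ k) x + partial j (\<lambda>z. hyperbolic_metric z $ i $ k) x
       - partial k (\<lambda>z. hyperbolic_metric z $ i $ j) x) / 2"
    unfolding christoffel_def matrix_inv_hyperbolic_metric[OF assms]
    using exhaust_3[of k] by (auto simp: mat_def sum_3)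
  moreover have "t\<^sup>2 * (- 2 / t^3 * a + - 2 / t^3 * b - - 2 / t^3 * c) / 2 = - (a + b - c) / t"
    if "t > 0" for a b c t :: real
    using that by (simp add: field_simps power2_eq_square power3_eq_cube)
  ultimately show ?thesis
    unfolding partial_hyperbolic_metric[OF assms] using assms by metis
qed

lemma christoffel_term_hyperbolic:
  assumes "x$3 > 0"
  shows "(\<chi> k. \<Sum>i\<in>UNIV. \<Sum>j\<in>UNIV. christoffel hyperbolic_metric x k i j * u $ i * v $ j)
    = (- 1 / x$3) *\<^sub>R (u$3 *\<^sub>R v + v$3 *\<^sub>R u - (u \<bullet> v) *\<^sub>R axis 3 1)"
  unfolding christoffel_hyperbolic[OF assms] vec_eq_iff forall_3
  using assms by (simp add: sum_3 inner_vec_def axis_def field_simps)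

lemma second_form_hyperbolic:
  assumes "C2_derivs U h h' h''" "y \<in> U" "\<And>z. z \<in> U \<Longrightarrow> F z = h z"
    and pos: "h y $ 3 > 0" and N: "\<And>v. h' y v \<bullet> N = 0"
  shows "second_form hyperbolic_metric F y N u v
    = (h'' y u v \<bullet> N + (h' y u \<bullet> h' y v) * N$3 / h y $ 3) / (h y $ 3)\<^sup>2"
proof -
  have "F y = h y" using assms by simp
  then have cov: "covariant_D hyperbolic_metric F y u v = h'' y u v +
     (- 1 / h y $ 3) *\<^sub>R (h' y u $ 3 *\<^sub>R h' y v + h' y v $ 3 *\<^sub>R h' y u - (h' y u \<bullet> h' y v) *\<^sub>R axis 3 1)"
    unfolding covariant_D_def using C2_derivs_D1[of U h h' h'' y F] C2_derivs_D2[of U h h' h'' y F]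
      christoffel_term_hyperbolic pos assms by simp
  show ?thesis
    unfolding second_form_def metric_inner_hyperbolic \<open>F y = h y\<close> cov
      inner_add_left inner_diff_left inner_scaleR_left N
    using pos by (simp add: inner_axis' field_simps)
qed

section \<open>Curvature in a chart\<close>

definition conormal :: "(real^2 \<Rightarrow> (real^2) \<Rightarrow>\<^sub>L (real^3)) \<Rightarrow> real^2 \<Rightarrow> real^3" where
  "conormal h' y = cross3 (h' y (axis 1 1)) (h' y (axis 2 1))"

definition scaled_second_form :: "(real^2 \<Rightarrow> real^3) \<Rightarrow> (real^2 \<Rightarrow> (real^2) \<Rightarrow>\<^sub>L (real^3)) \<Rightarrow>
    (real^2 \<Rightarrow> (real^2) \<Rightarrow>\<^sub>L (real^2) \<Rightarrow>\<^sub>L (real^3)) \<Rightarrow> real^2 \<Rightarrow> real^2 \<Rightarrow> real^2 \<Rightarrow> real" where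
  "scaled_second_form h h' h'' y u v = h y $ 3 * (h'' y u v \<bullet> conormal h' y)
     + conormal h' y $ 3 * (h' y u \<bullet> h' y v)"

definition chart_curvature :: "(real^2 \<Rightarrow> real^3) \<Rightarrow> (real^2 \<Rightarrow> (real^2) \<Rightarrow>\<^sub>L (real^3)) \<Rightarrow>
    (real^2 \<Rightarrow> (real^2) \<Rightarrow>\<^sub>L (real^2) \<Rightarrow>\<^sub>L (real^3)) \<Rightarrow> real^2 \<Rightarrow> real" where
  "chart_curvature h h' h'' y =
     (scaled_second_form h h' h'' y (axis 1 1) (axis 1 1) * scaled_second_form h h' h'' y (axis 2 1) (axis 2 1)
       - (scaled_second_form h h' h'' y (axis 1 1) (axis 2 1))\<^sup>2) / (conormal h' y \<bullet> conormal h' y)\<^sup>2"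

lemma vec2_expand: "v = v$1 *\<^sub>R axis 1 1 + v$2 *\<^sub>R axis 2 (1::real)" for v :: "real^2"
  by (simp add: vec_eq_iff forall_2 axis_def)

lemma conormal_orthogonal: "blinfun_apply (h' y) v \<bullet> conormal h' y = 0"
proof -
  have "h' y v = v$1 *\<^sub>R h' y (axis 1 1) + v$2 *\<^sub>R h' y (axis 2 1)"
    by (subst vec2_expand[of v]) (simp only: blinfun.add_right blinfun.scaleR_right)
  then show ?thesis by (simp add: conormal_def inner_add_left dot_cross_self)
qed

lemma independent_pair_iff:
  fixes v w :: "real^2"
  shows "v \<noteq> w \<and> independent {v, w} \<longleftrightarrow> v$1 * w$2 - w$1 * v$2 \<noteq> 0"
proof
  assume *: "v \<noteq> w \<and> independent {v, w}"
  then have w: "w \<noteq> 0" and v: "v \<notin> span {w}"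
    by (auto simp: independent_insert)
  show "v$1 * w$2 - w$1 * v$2 \<noteq> 0"
  proof
    assume det: "v$1 * w$2 - w$1 * v$2 = 0"
    have "v = (if w$1 = 0 then v$2 / w$2 else v$1 / w$1) *\<^sub>R w"
      using w det by (auto simp: vec_eq_iff forall_2 field_simps)
    then show False using v by (metis span_singleton rangeI)
  qed
next
  assume det: "v$1 * w$2 - w$1 * v$2 \<noteq> 0"
  then have "v \<notin> span {w}" by (auto simp: span_singleton)
  moreover have "w \<noteq> 0" using det by auto
  moreover have "v \<noteq> w" using det by auto
  ultimately show "v \<noteq> w \<and> independent {v, w}"
    by (simp add: independent_insert)
qed

context
  fixes U :: "(real^2) set" and h :: "real^2 \<Rightarrow> real^3" and h' h'' and F :: "real^2 \<Rightarrow> real^3"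
    and y :: "real^2"
  assumes C2: "C2_derivs U h h' h''" and y: "y \<in> U" and Fh: "\<And>z. z \<in> U \<Longrightarrow> F z = h z"
    and pos: "h y $ 3 > 0"
begin

lemma first_form_hyperbolic:
  "first_form hyperbolic_metric F y u v = (h' y u \<bullet> h' y v) / (h y $ 3)\<^sup>2"
  using C2_derivs_D1[of U h h' h'' y F] C2 y Fh by (simp add: first_form_def metric_inner_hyperbolic)

lemma area_density_hyperbolic:
  "area_density hyperbolic_metric F y = norm (conormal h' y) / (h y $ 3)\<^sup>2"
proof -
  let ?a = "h' y (axis 1 1)" and ?b = "h' y (axis 2 1)"
  have "(?a \<bullet> ?a) / (h y $ 3)\<^sup>2 * ((?b \<bullet> ?b) / (h y $ 3)\<^sup>2) - (?a \<bullet> ?b) / (h y $ 3)\<^sup>2 * ((?b \<bullet> ?a) / (h y $ 3)\<^sup>2)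
    = ((?a \<bullet> ?a) * (?b \<bullet> ?b) - (?a \<bullet> ?b)\<^sup>2) / ((h y $ 3)\<^sup>2)\<^sup>2"
    by (simp add: inner_commute[of ?b ?a] power2_eq_square diff_divide_distrib)
  also have "\<dots> = (norm (conormal h' y) / (h y $ 3)\<^sup>2)\<^sup>2"
    unfolding gram_det_cross conormal_def by (simp add: power_divide power2_norm_eq_inner)
  finally show ?thesis
    unfolding area_density_def det_2 vec_lambda_beta first_form_hyperbolic
    using pos by (simp add: real_sqrt_unique)
qed

lemma second_form_conormal:
  "second_form hyperbolic_metric F y (c *\<^sub>R conormal h' y) u v
    = c / h y $ 3 * scaled_second_form h h' h'' y u v / (h y $ 3)\<^sup>2"
  using second_form_hyperbolic[of U h h' h'' y F "c *\<^sub>R conormal h' y" u v]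
    C2 y Fh pos conormal_orthogonal
  by (simp add: scaled_second_form_def field_simps)

lemma principal_direction_conormal_iff:
  defines "B \<equiv> scaled_second_form h h' h'' y"
  shows "principal_direction hyperbolic_metric F y (c *\<^sub>R conormal h' y) k v \<longleftrightarrow> v \<noteq> 0 \<and>
    (c / h y $ 3 * B (axis 1 1) (axis 1 1)) * v$1 + (c / h y $ 3 * B (axis 1 1) (axis 2 1)) * v$2
      = k * ((h' y (axis 1 1) \<bullet> h' y (axis 1 1)) * v$1 + (h' y (axis 1 1) \<bullet> h' y (axis 2 1)) * v$2) \<and>
    (c / h y $ 3 * B (axis 1 1) (axis 2 1)) * v$1 + (c / h y $ 3 * B (axis 2 1) (axis 2 1)) * v$2
      = k * ((h' y (axis 1 1) \<bullet> h' y (axis 2 1)) * v$1 + (h' y (axis 2 1) \<bullet> h' y (axis 2 1)) * v$2)"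
    (is "_ \<longleftrightarrow> _ \<and> ?A1 = ?C1 \<and> ?A2 = ?C2")
proof -
  have sym: "B u v = B v u" for u v
    using C2_second_derivative_symmetric[OF C2 y, of u v]
    by (simp add: B_def scaled_second_form_def inner_commute)
  have lin: "B (a *\<^sub>R u + b *\<^sub>R v) w = a * B u w + b * B v w" for a b u v w
    by (simp add: B_def scaled_second_form_def blinfun.add_left blinfun.add_right blinfun.scaleR_left
        blinfun.scaleR_right inner_add_left algebra_simps)
  have B: "B v w = v$1 * B (axis 1 1) w + v$2 * B (axis 2 1) w" for v w
    by (subst vec2_expand[of v]) (simp only: lin)
  have g: "h' y v \<bullet> h' y w = v$1 * (h' y (axis 1 1) \<bullet> h' y w) + v$2 * (h' y (axis 2 1) \<bullet> h' y w)" for v w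
    by (subst vec2_expand[of v])
      (simp only: blinfun.add_right blinfun.scaleR_right inner_add_left inner_scaleR_left)
  have "second_form hyperbolic_metric F y (c *\<^sub>R conormal h' y) v w
        = k * first_form hyperbolic_metric F y v w
      \<longleftrightarrow> c / h y $ 3 * B v w = k * (h' y v \<bullet> h' y w)" for w
  proof -
    have "a / t\<^sup>2 = k * (b / t\<^sup>2) \<longleftrightarrow> a = k * b" if "t > 0" for a b t :: real
      using that by (simp add: field_simps)
    from this[OF pos] show ?thesis
      unfolding second_form_conormal first_form_hyperbolic B_def by blast
  qed
  moreover have "c / h y $ 3 * B v (axis 1 1) = ?A1" "c / h y $ 3 * B v (axis 2 1) = ?A2"
    unfolding B[of v] sym[of "axis 2 1" "axis 1 1"] by (simp_all only: distrib_left mult_ac)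
  moreover have "k * (h' y v \<bullet> h' y (axis 1 1)) = ?C1" "k * (h' y v \<bullet> h' y (axis 2 1)) = ?C2"
    unfolding g[of v] inner_commute[of "h' y (axis 2 1)" "h' y (axis 1 1)"] by (simp_all only: mult_ac)
  moreover have "(\<forall>w. c / h y $ 3 * B v w = k * (h' y v \<bullet> h' y w)) \<longleftrightarrow>
      c / h y $ 3 * B v (axis 1 1) = k * (h' y v \<bullet> h' y (axis 1 1)) \<and>
      c / h y $ 3 * B v (axis 2 1) = k * (h' y v \<bullet> h' y (axis 2 1))" (is "?L \<longleftrightarrow> ?R")
  proof
    assume R: ?R
    show ?L
    proof
      fix w
      have "c / h y $ 3 * B v w
          = w$1 * (c / h y $ 3 * B v (axis 1 1)) + w$2 * (c / h y $ 3 * B v (axis 2 1))"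
        unfolding sym[of v w] B[of w] sym[of v "axis _ 1"] by (simp only: distrib_left mult_ac)
      also have "\<dots> = k * (h' y v \<bullet> h' y w)"
        unfolding R[THEN conjunct1] R[THEN conjunct2] inner_commute[of "h' y v" "h' y w"] g[of w]
          inner_commute[of "h' y v" "h' y (axis _ 1)"]
        by (simp only: distrib_left mult_ac)
      finally show "c / h y $ 3 * B v w = k * (h' y v \<bullet> h' y w)" .
    qed
  qed blast
  ultimately show ?thesis unfolding principal_direction_def by (simp only:)
qed

lemma unit_normal_conormal_iff:
  assumes "conormal h' y \<noteq> 0"
  shows "unit_normal hyperbolic_metric F y N \<longleftrightarrow>
    (\<exists>c. N = c *\<^sub>R conormal h' y \<and> (c / h y $ 3)\<^sup>2 * (conormal h' y \<bullet> conormal h' y) = 1)"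
proof -
  have un: "unit_normal hyperbolic_metric F y N \<longleftrightarrow> (\<forall>v. h' y v \<bullet> N = 0) \<and> (N \<bullet> N) / (h y $ 3)\<^sup>2 = 1"
    using C2_derivs_D1[of U h h' h'' y F] C2 y Fh pos by (simp add: unit_normal_def metric_inner_hyperbolic)
  show ?thesis
  proof
    assume N: "unit_normal hyperbolic_metric F y N"
    then obtain c where c: "N = c *\<^sub>R conormal h' y"
      using un cross_product_parallel assms unfolding conormal_def by metis
    have "(c / h y $ 3)\<^sup>2 * (conormal h' y \<bullet> conormal h' y) = (N \<bullet> N) / (h y $ 3)\<^sup>2"
      using c by (simp add: power2_eq_square)
    then have "(c / h y $ 3)\<^sup>2 * (conormal h' y \<bullet> conormal h' y) = 1"
      using N un by metis
    then show "\<exists>c. N = c *\<^sub>R conormal h' y \<and> (c / h y $ 3)\<^sup>2 * (conormal h' y \<bullet> conormal h' y) = 1"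
      using c by blast
  next
    assume "\<exists>c. N = c *\<^sub>R conormal h' y \<and> (c / h y $ 3)\<^sup>2 * (conormal h' y \<bullet> conormal h' y) = 1"
    then show "unit_normal hyperbolic_metric F y N"
      unfolding un by (auto simp: conormal_orthogonal power2_eq_square)
  qed
qed

lemma principal_curvatures_product:
  assumes "conormal h' y \<noteq> 0" "unit_normal hyperbolic_metric F y N"
    and "principal_curvatures hyperbolic_metric F y N k1 k2"
  shows "k1 * k2 = chart_curvature h h' h'' y"
proof -
  obtain c where c: "N = c *\<^sub>R conormal h' y" "(c / h y $ 3)\<^sup>2 * (conormal h' y \<bullet> conormal h' y) = 1"
    using assms unit_normal_conormal_iff by blast
  obtain v w where vw: "v$1 * w$2 - w$1 * v$2 \<noteq> 0" "principal_direction hyperbolic_metric F y N k1 v"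
    "principal_direction hyperbolic_metric F y N k2 w"
    using assms(3) unfolding principal_curvatures_def using independent_pair_iff by blast
  let ?n = "conormal h' y \<bullet> conormal h' y"
  let ?B = "\<lambda>i j. scaled_second_form h h' h'' y (axis i 1) (axis j 1)"
  have n: "?n > 0" using assms(1) by simp
  have "(c / h y $ 3 * ?B 1 1) * (c / h y $ 3 * ?B 2 2) - (c / h y $ 3 * ?B 1 2)\<^sup>2
     = k1 * k2 * ((h' y (axis 1 1) \<bullet> h' y (axis 1 1)) * (h' y (axis 2 1) \<bullet> h' y (axis 2 1))
        - (h' y (axis 1 1) \<bullet> h' y (axis 2 1))\<^sup>2)"
    using vw(2,3) unfolding c(1) principal_direction_conormal_iff
    by (intro coupled_eigen_product[OF _ _ _ _ vw(1)]) blast+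
  then have eq: "(c / h y $ 3)\<^sup>2 * (?B 1 1 * ?B 2 2 - (?B 1 2)\<^sup>2) = k1 * k2 * ?n"
    unfolding gram_det_cross conormal_def[symmetric]
    by (simp add: power2_eq_square right_diff_distrib mult_ac)
  have "(c / h y $ 3)\<^sup>2 * ?n * (?B 1 1 * ?B 2 2 - (?B 1 2)\<^sup>2)
      = (c / h y $ 3)\<^sup>2 * (?B 1 1 * ?B 2 2 - (?B 1 2)\<^sup>2) * ?n"
    by (simp only: mult_ac)
  also have "\<dots> = k1 * k2 * ?n\<^sup>2"
    by (subst eq) (simp only: power2_eq_square mult_ac)
  finally show ?thesis
    unfolding c(2) chart_curvature_def using n by (simp add: field_simps)
qed

lemma principal_curvatures_exist:
  assumes "conormal h' y \<noteq> 0"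
  obtains N k1 k2 where "unit_normal hyperbolic_metric F y N"
    "principal_curvatures hyperbolic_metric F y N k1 k2"
proof -
  define c where "c = h y $ 3 / norm (conormal h' y)"
  have N: "unit_normal hyperbolic_metric F y (c *\<^sub>R conormal h' y)"
    unfolding unit_normal_conormal_iff[OF assms] using assms pos
    by (intro exI[of _ c]) (simp add: c_def power_divide power2_norm_eq_inner)
  have "h' y (axis 1 1) \<noteq> 0" using assms by (auto simp: conormal_def)
  then have E: "h' y (axis 1 1) \<bullet> h' y (axis 1 1) > 0" by simp
  have D: "(h' y (axis 1 1) \<bullet> h' y (axis 1 1)) * (h' y (axis 2 1) \<bullet> h' y (axis 2 1))
        - (h' y (axis 1 1) \<bullet> h' y (axis 2 1))\<^sup>2 > 0"
    unfolding gram_det_cross using assms by (simp add: conormal_def)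
  obtain k1 k2 x1 y1 x2 y2 where *:
    "(c / h y $ 3 * scaled_second_form h h' h'' y (axis 1 1) (axis 1 1)) * x1
      + (c / h y $ 3 * scaled_second_form h h' h'' y (axis 1 1) (axis 2 1)) * y1
      = k1 * ((h' y (axis 1 1) \<bullet> h' y (axis 1 1)) * x1 + (h' y (axis 1 1) \<bullet> h' y (axis 2 1)) * y1)"
    "(c / h y $ 3 * scaled_second_form h h' h'' y (axis 1 1) (axis 2 1)) * x1
      + (c / h y $ 3 * scaled_second_form h h' h'' y (axis 2 1) (axis 2 1)) * y1
      = k1 * ((h' y (axis 1 1) \<bullet> h' y (axis 2 1)) * x1 + (h' y (axis 2 1) \<bullet> h' y (axis 2 1)) * y1)"
    "(c / h y $ 3 * scaled_second_form h h' h'' y (axis 1 1) (axis 1 1)) * x2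
      + (c / h y $ 3 * scaled_second_form h h' h'' y (axis 1 1) (axis 2 1)) * y2
      = k2 * ((h' y (axis 1 1) \<bullet> h' y (axis 1 1)) * x2 + (h' y (axis 1 1) \<bullet> h' y (axis 2 1)) * y2)"
    "(c / h y $ 3 * scaled_second_form h h' h'' y (axis 1 1) (axis 2 1)) * x2
      + (c / h y $ 3 * scaled_second_form h h' h'' y (axis 2 1) (axis 2 1)) * y2
      = k2 * ((h' y (axis 1 1) \<bullet> h' y (axis 2 1)) * x2 + (h' y (axis 2 1) \<bullet> h' y (axis 2 1)) * y2)"
    "x1 * y2 - x2 * y1 \<noteq> 0"
    by (rule coupled_eigenbasis[OF E D, of
          "c / h y $ 3 * scaled_second_form h h' h'' y (axis 1 1) (axis 1 1)"
          "c / h y $ 3 * scaled_second_form h h' h'' y (axis 1 1) (axis 2 1)"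
          "c / h y $ 3 * scaled_second_form h h' h'' y (axis 2 1) (axis 2 1)"])
  define v w :: "real^2" where "v = vector [x1, y1]" and "w = vector [x2, y2]"
  have [simp]: "v$1 = x1" "v$2 = y1" "w$1 = x2" "w$2 = y2" by (simp_all add: v_def w_def)
  have vw: "v \<noteq> w \<and> independent {v, w}" unfolding independent_pair_iff using *(5) by simp
  then have "v \<noteq> 0" "w \<noteq> 0" using dependent_zero by blast+
  then have "principal_curvatures hyperbolic_metric F y (c *\<^sub>R conormal h' y) k1 k2"
    unfolding principal_curvatures_def principal_direction_conormal_iff
    using vw *(1-4) by (intro exI[of _ v] exI[of _ w]) simp
  with N show ?thesis by (rule that)
qed

end

section \<open>Change of parameters\<close>

lemma C2_derivs_compose:
  assumes h: "C2_derivs U h h' h''" and g: "C2_derivs V g g' g''" and t: "C2_derivs U t t' t''"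
    and tV: "\<And>z. z \<in> U \<Longrightarrow> t z \<in> V" and eq: "\<And>z. z \<in> U \<Longrightarrow> h z = g (t z)" and y: "y \<in> U"
  shows C2_derivs_compose_first: "h' y v = g' (t y) (t' y v)"
    and C2_derivs_compose_second: "h'' y u v = g'' (t y) (t' y u) (t' y v) + g' (t y) (t'' y u v)"
proof -
  note dh = C2_derivsD[OF h] and dg = C2_derivsD[OF g] and dt = C2_derivsD[OF t]
  have first: "h' z v = g' (t z) (t' z v)" if z: "z \<in> U" for z v
  proof -
    have "((\<lambda>z. g (t z)) has_derivative (\<lambda>v. g' (t z) (t' z v))) (at z)"
      using has_derivative_compose[OF dt(2)[OF z] dg(2)[OF tV[OF z]]] by simp
    then have "(h has_derivative (\<lambda>v. g' (t z) (t' z v))) (at z)"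
      by (rule has_derivative_transform_within_open[OF _ dh(1) z]) (simp add: eq)
    then have "(\<lambda>v. g' (t z) (t' z v)) = h' z"
      using dh(2)[OF z] has_derivative_unique by blast
    then show ?thesis by metis
  qed
  from first[OF y] show "h' y v = g' (t y) (t' y v)" .
  have "((\<lambda>z. h' z v) has_derivative (\<lambda>u. h'' y u v)) (at y)"
    by (intro bounded_linear.has_derivative
        [OF bounded_bilinear.bounded_linear_left[OF bounded_bilinear_blinfun_apply]] dh(3) y)
  moreover have "((\<lambda>z. g' (t z) (t' z v)) has_derivative
      (\<lambda>u. g' (t y) (t'' y u v) + g'' (t y) (t' y u) (t' y v))) (at y)"
  proof (rule bounded_bilinear.FDERIV[OF bounded_bilinear_blinfun_apply])
    show "((\<lambda>z. g' (t z)) has_derivative (\<lambda>u. g'' (t y) (t' y u))) (at y)"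
      using has_derivative_compose[OF dt(2)[OF y] dg(3)[OF tV[OF y]]] by simp
    show "((\<lambda>z. t' z v) has_derivative (\<lambda>u. t'' y u v)) (at y)"
      by (intro bounded_linear.has_derivative
        [OF bounded_bilinear.bounded_linear_left[OF bounded_bilinear_blinfun_apply]] dt(3) y)
  qed
  then have "((\<lambda>z. h' z v) has_derivative
      (\<lambda>u. g' (t y) (t'' y u v) + g'' (t y) (t' y u) (t' y v))) (at y)"
    by (rule has_derivative_transform_within_open[OF _ dh(1) y]) (simp add: first)
  ultimately have "(\<lambda>u. h'' y u v) = (\<lambda>u. g' (t y) (t'' y u v) + g'' (t y) (t' y u) (t' y v))"
    by (rule has_derivative_unique)
  then have "h'' y u v = g' (t y) (t'' y u v) + g'' (t y) (t' y u) (t' y v)" by metis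
  then show "h'' y u v = g'' (t y) (t' y u) (t' y v) + g' (t y) (t'' y u v)" by simp
qed

lemma principal_curvatures_reparametrize:
  fixes h :: "real^2 \<Rightarrow> real^3" and t :: "real^2 \<Rightarrow> real^2"
  assumes h: "C2_derivs U h h' h''" and g: "C2_derivs V g g' g''" and t: "C2_derivs U t t' t''"
    and tV: "\<And>z. z \<in> U \<Longrightarrow> t z \<in> V" and eq: "\<And>z. z \<in> U \<Longrightarrow> h z = g (t z)" and y: "y \<in> U"
    and F: "\<And>z. z \<in> U \<Longrightarrow> F z = h z" and G: "\<And>z. z \<in> V \<Longrightarrow> G z = g z"
    and inj: "inj (blinfun_apply (h' y))" and pos: "h y $ 3 > 0"
    and N: "unit_normal hyperbolic_metric F y N"
    and k: "principal_curvatures hyperbolic_metric F y N k1 k2"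
  shows "unit_normal hyperbolic_metric G (t y) N"
    and "principal_curvatures hyperbolic_metric G (t y) N k1 k2"
proof -
  note first = C2_derivs_compose_first[OF h g t tV eq y]
    and second = C2_derivs_compose_second[OF h g t tV eq y]
  have ty: "t y \<in> V" and hy: "h y = g (t y)" using tV eq y by auto
  have D1F: "D1 F y = h' y" using C2_derivs_D1[of U h h' h'' y F] h y F by blast
  have D1G: "D1 G (t y) = g' (t y)" using C2_derivs_D1[of V g g' g'' "t y" G] g ty G by blast
  have Fy: "F y = h y" "G (t y) = h y" using F G y ty hy by auto
  have inj_t: "inj (t' y)"
    using inj first unfolding inj_def by metis
  then have surj_t: "surj (t' y)"
    by (simp add: linear_injective_imp_surjective blinfun.bounded_linear_right bounded_linear.linear)
  have all_t: "(\<forall>w. P w) \<longleftrightarrow> (\<forall>v. P (t' y v))" for P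
  proof
    assume P: "\<forall>v. P (t' y v)"
    show "\<forall>w. P w"
    proof
      fix w
      obtain v where "w = t' y v" using surj_t by (rule surjE)
      then show "P w" using P by simp
    qed
  qed blast
  show NG: "unit_normal hyperbolic_metric G (t y) N"
    using N unfolding unit_normal_def D1G D1F Fy by (subst all_t) (simp add: first)
  have orthF: "h' y v \<bullet> N = 0" for v
    using N pos unfolding unit_normal_def metric_inner_hyperbolic D1F Fy by simp
  have orthG: "g' (t y) v \<bullet> N = 0" for v
    using NG pos unfolding unit_normal_def metric_inner_hyperbolic D1G Fy by simp
  have II: "second_form hyperbolic_metric F y N u v
      = second_form hyperbolic_metric G (t y) N (t' y u) (t' y v)" for u v
    using second_form_hyperbolic[of U h h' h'' y F N u v]
      second_form_hyperbolic[of V g g' g'' "t y" G N "t' y u" "t' y v"]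
      h y F pos orthF g ty G orthG hy
    by (simp add: first second inner_add_left)
  have I: "first_form hyperbolic_metric F y u v = first_form hyperbolic_metric G (t y) (t' y u) (t' y v)" for u v
    unfolding first_form_def D1F D1G Fy by (simp only: first)
  have t0: "t' y v \<noteq> 0 \<longleftrightarrow> v \<noteq> 0" for v
    using inj_t by (metis blinfun.zero_right injD)
  have pd: "principal_direction hyperbolic_metric G (t y) N k (t' y v)"
    if "principal_direction hyperbolic_metric F y N k v" for k v
    using that unfolding principal_direction_def II I t0 by (subst all_t) blast
  obtain v w where vw: "v \<noteq> w" "independent {v, w}"
    "principal_direction hyperbolic_metric F y N k1 v" "principal_direction hyperbolic_metric F y N k2 w"
    using k unfolding principal_curvatures_def by blast
  have "independent (t' y ` {v, w})"
    using vw inj_t by (intro linear_independent_injective_image)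
      (auto intro: inj_on_subset simp: blinfun.bounded_linear_right bounded_linear.linear)
  then show "principal_curvatures hyperbolic_metric G (t y) N k1 k2"
    unfolding principal_curvatures_def using vw pd inj_t
    by (intro exI[of _ "t' y v"] exI[of _ "t' y w"]) (auto dest: injD)
qed

section \<open>Growth of the curvature at the ideal boundary\<close>

lemma continuous_on_compact_bounded:
  fixes f :: "'a::topological_space \<Rightarrow> 'b::real_normed_vector"
  assumes "compact K" "continuous_on K f"
  obtains B where "B > 0" "\<And>x. x \<in> K \<Longrightarrow> norm (f x) \<le> B"
  using compact_imp_bounded[OF compact_continuous_image[OF assms(2,1)]]
  unfolding bounded_pos by (auto simp: image_iff)

lemma conormal_continuous_on:
  assumes "C2_derivs V h h' h''"
  shows "continuous_on V (conormal h')"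
  unfolding conormal_def
  by (intro continuous_on_cross continuous_intros C2_derivs_continuous[OF assms])

lemma conormal_has_derivative:
  assumes "C2_derivs V h h' h''" "y \<in> V"
  shows "(conormal h' has_derivative (\<lambda>u. cross3 (h' y (axis 1 1)) (h'' y u (axis 2 1))
     + cross3 (h'' y u (axis 1 1)) (h' y (axis 2 1)))) (at y)"
proof -
  have "((\<lambda>z. h' z v) has_derivative (\<lambda>u. h'' y u v)) (at y)" for v
    by (intro bounded_linear.has_derivative
        [OF bounded_bilinear.bounded_linear_left[OF bounded_bilinear_blinfun_apply]] C2_derivsD(3)[OF assms])
  moreover have "bounded_bilinear cross3"
    using bilinear_cross by (simp add: bilinear_conv_bounded_bilinear)
  ultimately show ?thesis
    unfolding conormal_def[abs_def] by (intro bounded_bilinear.FDERIV)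
qed

lemma vertical_mean_value:
  fixes q :: "real^2 \<Rightarrow> real"
  assumes der: "\<And>z. z \<in> V \<Longrightarrow> (q has_derivative q' z) (at z)"
    and seg: "\<And>s. 0 \<le> s \<Longrightarrow> s \<le> y$2 \<Longrightarrow> vector [y$1, s] \<in> V"
    and y: "y$2 > 0"
  obtains s where "0 < s" "s < y$2" "q y = q (vector [y$1, 0]) + y$2 * q' (vector [y$1, s]) (axis 2 1)"
proof -
  let ?c = "\<lambda>s. vector [y$1, s] :: real^2"
  have c: "?c = (\<lambda>s. y$1 *\<^sub>R axis 1 1 + s *\<^sub>R axis 2 1)"
    by (simp add: fun_eq_iff vec_eq_iff forall_2 axis_def)
  have "(?c has_derivative (\<lambda>r. r *\<^sub>R axis 2 1)) (at s within {0..y$2})" for s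
    unfolding c by (auto intro!: derivative_eq_intros)
  then have "((\<lambda>s. q (?c s)) has_derivative (\<lambda>r. q' (?c s) (r *\<^sub>R axis 2 1))) (at s within {0..y$2})"
    if "0 \<le> s" "s \<le> y$2" for s
    using has_derivative_compose[of ?c "\<lambda>r. r *\<^sub>R axis 2 1" s "{0..y$2}" q "q' (?c s)"]
      der[OF seg[OF that]] by blast
  then obtain s where "s \<in> {0<..<y$2}" "q (?c (y$2)) - q (?c 0) = q' (?c s) ((y$2 - 0) *\<^sub>R axis 2 1)"
    using mvt_simple[OF y, of "\<lambda>s. q (?c s)" "\<lambda>s r. q' (?c s) (r *\<^sub>R axis 2 1)"] by auto
  moreover have "linear (q' (?c s))"
    using der seg[of s] calculation has_derivative_linear by auto
  moreover have "?c (y$2) = y" by (simp add: vec_eq_iff forall_2)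
  ultimately show ?thesis
    using that[of s] by (simp add: linear_cmul)
qed

lemma half_plane_segment:
  assumes "y \<in> half_plane" "y0 \<in> half_plane" "y0$2 = 0" "dist y0 y \<le> r" "0 \<le> s" "s \<le> y$2"
  shows "vector [y$1, s] \<in> cball y0 r \<inter> half_plane"
proof -
  have "(dist y0 (vector [y$1, s]))\<^sup>2 \<le> (dist y0 y)\<^sup>2"
    using assms by (simp add: dist_norm power2_norm_eq_inner inner_vec_def sum_2 mult_mono)
  then have "dist y0 (vector [y$1, s]) \<le> dist y0 y"
    by (rule power2_le_imp_le) simp
  then show ?thesis using assms by (simp add: half_plane_def)
qed

text \<open>The quantity \<open>conormal h' y $ 3\<close> vanishes along the boundary, to first order like the height
  \<open>h y $ 3\<close>; this is where orthogonality to the ideal boundary enters.\<close>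

lemma conormal_height_bound_boundary:
  assumes C2: "C2_derivs V h h' h''" and y0: "y0 \<in> V" "y0$2 = 0"
    and ne: "conormal h' y0 \<noteq> 0"
    and bd: "\<And>z. z \<in> V \<Longrightarrow> z$2 = 0 \<Longrightarrow> h z $ 3 = 0 \<and> conormal h' z $ 3 = 0"
    and pos: "\<And>z. z \<in> V \<Longrightarrow> z$2 > 0 \<Longrightarrow> h z $ 3 > 0"
  obtains r M where "r > 0" "cball y0 r \<subseteq> V" "M > 0"
    "\<And>z. z \<in> cball y0 r \<Longrightarrow> z$2 > 0 \<Longrightarrow> \<bar>conormal h' z $ 3\<bar> \<le> M * h z $ 3"
proof -
  note d = C2_derivsD[OF C2]
  let ?e1 = "axis 1 1 :: real^2" and ?e2 = "axis 2 1 :: real^2"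
  have tangential: "h' y0 ?e1 $ 3 = 0"
  proof -
    obtain e where e: "e > 0" "ball y0 e \<subseteq> V" using d(1) y0 open_contains_ball by blast
    have "((\<lambda>t::real. y0 + t *\<^sub>R ?e1) has_derivative (\<lambda>t. t *\<^sub>R ?e1)) (at 0)"
      by (auto intro!: derivative_eq_intros)
    then have "((\<lambda>t. h (y0 + t *\<^sub>R ?e1)) has_derivative (\<lambda>t. h' y0 (t *\<^sub>R ?e1))) (at 0)"
      using has_derivative_compose[of "\<lambda>t. y0 + t *\<^sub>R ?e1" _ 0 UNIV h] d(2)[OF y0(1)] by simp
    then have "((\<lambda>t. h (y0 + t *\<^sub>R ?e1) $ 3) has_derivative (\<lambda>t. h' y0 (t *\<^sub>R ?e1) $ 3)) (at 0)"
      by (rule bounded_linear.has_derivative[OF bounded_linear_vec_nth])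
    then have "((\<lambda>t::real. 0::real) has_derivative (\<lambda>t. h' y0 (t *\<^sub>R ?e1) $ 3)) (at 0)"
    proof (rule has_derivative_transform_within_open[of _ _ _ _ "{-e<..<e}"])
      fix t assume "t \<in> {-e<..<e}"
      then have "y0 + t *\<^sub>R ?e1 \<in> V" using e by (intro subsetD[OF e(2)]) (auto simp: dist_norm)
      then show "h (y0 + t *\<^sub>R ?e1) $ 3 = 0" using bd y0 by (simp add: axis_def)
    qed (use e in auto)
    then have "(\<lambda>t. h' y0 (t *\<^sub>R ?e1) $ 3) = (\<lambda>t. 0)"
      using has_derivative_unique has_derivative_const by blast
    then have "h' y0 (1 *\<^sub>R ?e1) $ 3 = 0" by meson
    then show ?thesis by simp
  qed
  have transversal: "h' y0 ?e2 $ 3 \<noteq> 0"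
  proof
    assume "h' y0 ?e2 $ 3 = 0"
    then have "conormal h' y0 = 0"
      using tangential bd[OF y0] unfolding vec_eq_iff forall_3 by (simp add: conormal_def cross_components)
    then show False using ne by simp
  qed
  define c where "c = \<bar>h' y0 ?e2 $ 3\<bar> / 2"
  have c: "c > 0" using transversal by (simp add: c_def)
  have "continuous_on V (\<lambda>z. \<bar>h' z ?e2 $ 3\<bar>)"
    by (intro continuous_intros C2_derivs_continuous[OF C2])
  then have "open (V \<inter> (\<lambda>z. \<bar>h' z ?e2 $ 3\<bar>) -` {c<..})"
    using d(1) by (rule continuous_open_preimage) simp
  moreover have "y0 \<in> V \<inter> (\<lambda>z. \<bar>h' z ?e2 $ 3\<bar>) -` {c<..}" using y0 c by (simp add: c_def)
  ultimately obtain r where r: "r > 0" "cball y0 r \<subseteq> V \<inter> (\<lambda>z. \<bar>h' z ?e2 $ 3\<bar>) -` {c<..}"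
    using open_contains_cball by blast
  define q' where "q' z u = (cross3 (h' z ?e1) (h'' z u ?e2) + cross3 (h'' z u ?e1) (h' z ?e2)) $ 3" for z u
  have "continuous_on V (\<lambda>z. q' z ?e2)"
    unfolding q'_def
    by (intro continuous_on_cross continuous_intros C2_derivs_continuous[OF C2] d(4))
  then have "continuous_on (cball y0 r) (\<lambda>z. q' z ?e2)"
    using r continuous_on_subset by blast
  then obtain B where B: "B > 0" "\<And>z. z \<in> cball y0 r \<Longrightarrow> norm (q' z ?e2) \<le> B"
    by (rule continuous_on_compact_bounded[OF compact_cball]; blast)
  have "\<bar>conormal h' z $ 3\<bar> \<le> B / c * h z $ 3" if z: "z \<in> cball y0 r" "z$2 > 0" for z
  proof -
    have seg: "vector [z$1, s] \<in> cball y0 r" if "0 \<le> s" "s \<le> z$2" for s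
      using half_plane_segment[of z y0 r s] z y0 that by (simp add: half_plane_def)
    have segV: "vector [z$1, s] \<in> V" if "0 \<le> s" "s \<le> z$2" for s
      using seg[OF that] r by blast
    have bd0: "h (vector [z$1, 0]) $ 3 = 0" "conormal h' (vector [z$1, 0]) $ 3 = 0"
      using bd[OF segV[of 0]] z by auto
    have "((\<lambda>z. h z $ 3) has_derivative (\<lambda>u. h' z u $ 3)) (at z)" if "z \<in> V" for z
      by (rule bounded_linear.has_derivative[OF bounded_linear_vec_nth d(2)[OF that]])
    then obtain s where s: "0 < s" "s < z$2" "h z $ 3 = z$2 * h' (vector [z$1, s]) ?e2 $ 3"
      using vertical_mean_value[of V "\<lambda>z. h z $ 3" "\<lambda>z u. h' z u $ 3" z] segV z bd0 by auto
    have "((\<lambda>z. conormal h' z $ 3) has_derivative q' z) (at z)" if "z \<in> V" for z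
      unfolding q'_def[abs_def]
      by (rule bounded_linear.has_derivative[OF bounded_linear_vec_nth conormal_has_derivative[OF C2 that]])
    then obtain s' where s': "0 < s'" "s' < z$2" "conormal h' z $ 3 = z$2 * q' (vector [z$1, s']) ?e2"
      using vertical_mean_value[of V "\<lambda>z. conormal h' z $ 3" q' z] segV z bd0 by auto
    have "\<bar>conormal h' z $ 3\<bar> \<le> z$2 * B"
      using s' z B(2)[OF seg[of s']] by (simp add: abs_mult)
    moreover have "h z $ 3 > 0" using pos z r by blast
    then have "z$2 * c \<le> h z $ 3"
    proof -
      have "c < \<bar>h' (vector [z$1, s]) ?e2 $ 3\<bar>" using seg[of s] s r by auto
      then have "z$2 * c \<le> z$2 * \<bar>h' (vector [z$1, s]) ?e2 $ 3\<bar>"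
        using z(2) by (intro mult_left_mono) auto
      also have "\<dots> = \<bar>h z $ 3\<bar>" unfolding s(3) using z(2) by (simp add: abs_mult)
      finally show ?thesis using \<open>h z $ 3 > 0\<close> by simp
    qed
    then have "B / c * (z$2 * c) \<le> B / c * h z $ 3"
      using B c by (intro mult_left_mono) auto
    ultimately show ?thesis using c by (simp add: mult.commute)
  qed
  then show ?thesis
    using that[of r "B / c"] r B c by auto
qed

lemma chart_curvature_height_bound:
  assumes C2: "C2_derivs V h h' h''" and y0: "y0 \<in> V"
    and ne: "conormal h' y0 \<noteq> 0"
    and bd: "\<And>z. z \<in> V \<Longrightarrow> z$2 = 0 \<Longrightarrow> h z $ 3 = 0 \<and> conormal h' z $ 3 = 0"
    and pos: "\<And>z. z \<in> V \<Longrightarrow> z$2 > 0 \<Longrightarrow> h z $ 3 > 0" and half: "y0$2 \<ge> 0"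
  obtains r M A where "r > 0" "ball y0 r \<subseteq> V" "M \<ge> 0" "A \<ge> 0" "\<And>z. z \<in> ball y0 r \<Longrightarrow> conormal h' z \<noteq> 0"
    "\<And>z. z \<in> ball y0 r \<Longrightarrow> norm (conormal h' z) \<le> A"
    "\<And>z. z \<in> ball y0 r \<Longrightarrow> z$2 > 0 \<Longrightarrow> \<bar>chart_curvature h h' h'' z\<bar> \<le> M * (h z $ 3)\<^sup>2"
proof -
  note d = C2_derivsD[OF C2]
  obtain r1 M1 where r1: "r1 > 0" "cball y0 r1 \<subseteq> V" "M1 > 0"
    "\<And>z. z \<in> cball y0 r1 \<Longrightarrow> z$2 > 0 \<Longrightarrow> \<bar>conormal h' z $ 3\<bar> \<le> M1 * h z $ 3"
  proof (cases "y0$2 = 0")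
    case True
    then show ?thesis
      using conormal_height_bound_boundary[OF C2 y0 True ne] bd pos that by blast
  next
    case False
    have "open (V \<inter> {z. z$2 > 0})"
      by (intro open_Int d open_Collect_less continuous_intros)
    moreover have "y0 \<in> V \<inter> {z. z$2 > 0}" using y0 False half by simp
    ultimately obtain r where r: "r > 0" "cball y0 r \<subseteq> V \<inter> {z. z$2 > 0}"
      using open_contains_cball by blast
    have "continuous_on (V \<inter> {z. z$2 > 0}) (\<lambda>z. conormal h' z $ 3 / h z $ 3)"
      using pos by (intro continuous_intros continuous_on_subset[OF conormal_continuous_on[OF C2]]
         continuous_on_subset[OF C2_derivs_continuous(1)[OF C2]]) force+
    then have "continuous_on (cball y0 r) (\<lambda>z. conormal h' z $ 3 / h z $ 3)"
      using r continuous_on_subset by blast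
    then obtain B where B: "B > 0" "\<And>z. z \<in> cball y0 r \<Longrightarrow> norm (conormal h' z $ 3 / h z $ 3) \<le> B"
      by (rule continuous_on_compact_bounded[OF compact_cball]; blast)
    have "\<bar>conormal h' z $ 3\<bar> \<le> B * h z $ 3" if "z \<in> cball y0 r" for z
    proof -
      have "h z $ 3 > 0" using pos r that by blast
      then show ?thesis using B(2)[OF that] by (simp add: field_simps)
    qed
    then show ?thesis using that[of r B] r B by auto
  qed
  have "open (V \<inter> conormal h' -` (- {0}))"
    using conormal_continuous_on[OF C2] d(1) by (rule continuous_open_preimage) (simp add: open_Compl)
  moreover have "y0 \<in> V \<inter> conormal h' -` (- {0})" using y0 ne by simp
  ultimately obtain r2 where r2: "r2 > 0" "cball y0 r2 \<subseteq> V \<inter> conormal h' -` (- {0})"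
    using open_contains_cball by blast
  define K where "K = cball y0 (min r1 r2)"
  have K: "compact K" "K \<subseteq> V" "\<And>z. z \<in> K \<Longrightarrow> conormal h' z \<noteq> 0" "K \<subseteq> cball y0 r1"
    using r1 r2 by (auto simp: K_def)
  have contK: "continuous_on K (conormal h')" "continuous_on K h'" "continuous_on K h''"
    using conormal_continuous_on[OF C2] C2_derivs_continuous[OF C2] d(4) K(2) continuous_on_subset by blast+
  obtain A where A: "A > 0" "\<And>z. z \<in> K \<Longrightarrow> norm (conormal h' z) \<le> A"
    by (rule continuous_on_compact_bounded[OF K(1) contK(1)]; blast)
  define Q where "Q i j z = \<bar>h'' z (axis i 1) (axis j 1) \<bullet> conormal h' z\<bar>
    + M1 * \<bar>h' z (axis i 1) \<bullet> h' z (axis j 1)\<bar>" for i j z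
  have Qcont: "continuous_on K (\<lambda>z. Q i j z)" for i j
    unfolding Q_def by (intro continuous_intros contK)
  have Qb: "\<bar>scaled_second_form h h' h'' z (axis i 1) (axis j 1)\<bar> \<le> Q i j z * h z $ 3"
    if z: "z \<in> K" "z$2 > 0" for i j z
  proof -
    have hz: "h z $ 3 > 0" using pos K z by blast
    have n: "\<bar>conormal h' z $ 3\<bar> \<le> M1 * h z $ 3" using r1 K z by blast
    have "\<bar>scaled_second_form h h' h'' z (axis i 1) (axis j 1)\<bar>
      \<le> h z $ 3 * \<bar>h'' z (axis i 1) (axis j 1) \<bullet> conormal h' z\<bar>
        + \<bar>conormal h' z $ 3\<bar> * \<bar>h' z (axis i 1) \<bullet> h' z (axis j 1)\<bar>"
      unfolding scaled_second_form_def using hz by (intro order_trans[OF abs_triangle_ineq]) (simp add: abs_mult)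
    also have "\<dots> \<le> h z $ 3 * \<bar>h'' z (axis i 1) (axis j 1) \<bullet> conormal h' z\<bar>
        + M1 * h z $ 3 * \<bar>h' z (axis i 1) \<bullet> h' z (axis j 1)\<bar>"
      using n by (intro add_left_mono mult_right_mono) auto
    also have "\<dots> = Q i j z * h z $ 3" by (simp add: Q_def algebra_simps)
    finally show ?thesis .
  qed
  define P where "P z = (Q 1 1 z * Q 2 2 z + (Q 1 2 z)\<^sup>2) / (conormal h' z \<bullet> conormal h' z)\<^sup>2" for z
  have "continuous_on K P"
    unfolding P_def using K(3) by (intro continuous_intros Qcont contK) simp
  then obtain M where M: "M > 0" "\<And>z. z \<in> K \<Longrightarrow> norm (P z) \<le> M"
    by (rule continuous_on_compact_bounded[OF K(1)]; blast)
  have bound: "\<bar>chart_curvature h h' h'' z\<bar> \<le> M * (h z $ 3)\<^sup>2" if z: "z \<in> K" "z$2 > 0" for z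
  proof -
    let ?b = "\<lambda>i j. scaled_second_form h h' h'' z (axis i 1) (axis j 1)"
    have hz: "h z $ 3 > 0" using pos K z by blast
    have Q0: "Q i j z \<ge> 0" for i j using r1(3) by (simp add: Q_def)
    have "\<bar>?b 1 1 * ?b 2 2 - (?b 1 2)\<^sup>2\<bar> \<le> \<bar>?b 1 1\<bar> * \<bar>?b 2 2\<bar> + \<bar>?b 1 2\<bar>\<^sup>2"
      by (intro order_trans[OF abs_triangle_ineq4]) (simp add: abs_mult)
    also have "\<dots> \<le> (Q 1 1 z * h z $ 3) * (Q 2 2 z * h z $ 3) + (Q 1 2 z * h z $ 3)\<^sup>2"
      using Qb[OF z] Q0 hz by (intro add_mono mult_mono power_mono) auto
    also have "\<dots> = (Q 1 1 z * Q 2 2 z + (Q 1 2 z)\<^sup>2) * (h z $ 3)\<^sup>2"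
      by (simp add: power2_eq_square algebra_simps)
    finally have "\<bar>chart_curvature h h' h'' z\<bar> \<le> P z * (h z $ 3)\<^sup>2"
      unfolding chart_curvature_def P_def by (simp add: divide_right_mono)
    also have "\<dots> \<le> M * (h z $ 3)\<^sup>2"
      using M(2)[OF z(1)] by (intro mult_right_mono) auto
    finally show ?thesis .
  qed
  have ballK: "z \<in> K" if "z \<in> ball y0 (min r1 r2)" for z
    using that by (simp add: K_def)
  show ?thesis
  proof (rule that[of "min r1 r2" M A])
    show "ball y0 (min r1 r2) \<subseteq> V" using ballK K(2) by blast
    show "\<bar>chart_curvature h h' h'' z\<bar> \<le> M * (h z $ 3)\<^sup>2"
      if "z \<in> ball y0 (min r1 r2)" "z$2 > 0" for z
      using bound[OF ballK] that by simp
  qed (use r1(1) r2(1) M(1) A ballK K(3) in simp_all)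
qed

lemma chart_curvature_continuous_on:
  assumes "C2_derivs V h h' h''" "\<And>z. z \<in> V \<Longrightarrow> conormal h' z \<noteq> 0"
  shows "continuous_on V (chart_curvature h h' h'')"
  unfolding chart_curvature_def[abs_def] scaled_second_form_def
  using assms(2) by (intro continuous_intros conormal_continuous_on[OF assms(1)]
     C2_derivs_continuous[OF assms(1)] C2_derivsD(4)[OF assms(1)]) auto

section \<open>Integration over dyadic layers of the height\<close>

text \<open>On the layer where \<open>2\<^sup>i \<le> \<tau> < 2\<^sup>i\<^sup>+\<^sup>1\<close> the factors \<open>\<tau>\<^sup>2\<close> and \<open>1/\<tau>\<^sup>2\<close> cancel up to the constant 4, so it
  suffices to know \<open>\<mu>\<close> on sets, without transporting integrals along \<open>\<phi>\<close>.\<close>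

lemma nn_integral_dyadic_layers:
  fixes \<mu> :: "'a measure" and \<phi> :: "'a \<Rightarrow> 'b::euclidean_space" and \<tau> dens :: "'b \<Rightarrow> real" and k :: "'a \<Rightarrow> real"
  assumes D: "open D" "bounded D" "D \<subseteq> \<phi> ` U"
    and \<tau>: "continuous_on D \<tau>" "\<And>z. z \<in> D \<Longrightarrow> \<tau> z > 0"
    and sets: "\<And>B. open B \<Longrightarrow> B \<subseteq> D \<Longrightarrow> {p \<in> U. \<phi> p \<in> B} \<in> sets \<mu>"
    and emeas: "\<And>B. B \<in> sets \<mu> \<Longrightarrow> B \<subseteq> U \<Longrightarrow> emeasure \<mu> B = (\<integral>\<^sup>+y\<in>\<phi> ` B. ennreal (dens y) \<partial>lborel)"
    and dens: "\<And>z. z \<in> D \<Longrightarrow> dens z \<le> A / (\<tau> z)\<^sup>2"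
    and k: "k \<in> borel_measurable \<mu>" "\<And>p. p \<in> U \<Longrightarrow> \<phi> p \<in> D \<Longrightarrow> \<bar>k p\<bar> \<le> M * (\<tau> (\<phi> p))\<^sup>2"
    and nonneg: "A \<ge> 0" "M \<ge> 0"
  shows "(\<integral>\<^sup>+p\<in>{p \<in> U. \<phi> p \<in> D}. ennreal \<bar>k p\<bar> \<partial>\<mu>) < \<infinity>"
proof -
  define E where "E i = D \<inter> \<tau> -` {2 powr i ..< 2 * 2 powr i}" for i :: real
  define L where "L i = {p \<in> U. \<phi> p \<in> E i}" for i
  have Ediff: "E i = (D \<inter> \<tau> -` {..<2 * 2 powr i}) - (D \<inter> \<tau> -` {..<2 powr i})" for i
    by (auto simp: E_def)
  have op: "open (D \<inter> \<tau> -` {..<b})" for b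
    using \<tau>(1) D(1) by (rule continuous_open_preimage) simp
  have E_sets: "E i \<in> sets lborel" for i
    unfolding Ediff by (intro sets.Diff) (simp_all add: borel_open op)
  have "L i = {p \<in> U. \<phi> p \<in> D \<inter> \<tau> -` {..<2 * 2 powr i}} - {p \<in> U. \<phi> p \<in> D \<inter> \<tau> -` {..<2 powr i}}" for i
    by (auto simp: L_def Ediff)
  then have L_sets: "L i \<in> sets \<mu>" for i
    by (simp only:) (intro sets.Diff sets op Int_lower1)
  have image_L: "\<phi> ` L i = E i" for i
    using D(3) by (auto simp: L_def E_def)
  have layer: "(\<integral>\<^sup>+p\<in>L i. ennreal \<bar>k p\<bar> \<partial>\<mu>) \<le> ennreal (4 * M * A) * emeasure lborel (E i)" for i
  proof -
    have "emeasure \<mu> (L i) = (\<integral>\<^sup>+y\<in>E i. ennreal (dens y) \<partial>lborel)"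
      using emeas[OF L_sets, of i] image_L[of i] unfolding L_def by auto
    also have "\<dots> \<le> (\<integral>\<^sup>+y. ennreal (A / (2 powr i)\<^sup>2) * indicator (E i) y \<partial>lborel)"
    proof (intro nn_integral_mono)
      fix y show "ennreal (dens y) * indicator (E i) y \<le> ennreal (A / (2 powr i)\<^sup>2) * indicator (E i) y"
      proof (cases "y \<in> E i")
        case True
        then have "dens y \<le> A / (\<tau> y)\<^sup>2" by (intro dens) (simp add: E_def)
        also have "\<dots> \<le> A / (2 powr i)\<^sup>2"
          using True nonneg by (intro divide_left_mono power_mono mult_pos_pos zero_less_power) (auto simp: E_def \<tau>)
        finally show ?thesis using True by (simp add: ennreal_leI)
      qed simp
    qed
    also have "\<dots> = ennreal (A / (2 powr i)\<^sup>2) * emeasure lborel (E i)"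
      using E_sets by (intro nn_integral_cmult_indicator)
    finally have *: "emeasure \<mu> (L i) \<le> ennreal (A / (2 powr i)\<^sup>2) * emeasure lborel (E i)" .
    have "(\<integral>\<^sup>+p\<in>L i. ennreal \<bar>k p\<bar> \<partial>\<mu>) \<le> (\<integral>\<^sup>+p. ennreal (M * (2 * 2 powr i)\<^sup>2) * indicator (L i) p \<partial>\<mu>)"
    proof (intro nn_integral_mono)
      fix p show "ennreal \<bar>k p\<bar> * indicator (L i) p \<le> ennreal (M * (2 * 2 powr i)\<^sup>2) * indicator (L i) p"
      proof (cases "p \<in> L i")
        case True
        then have "p \<in> U" and p: "\<phi> p \<in> E i" by (simp_all add: L_def)
        then have "\<bar>k p\<bar> \<le> M * (\<tau> (\<phi> p))\<^sup>2" by (intro k) (simp_all add: E_def)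
        also have "\<dots> \<le> M * (2 * 2 powr i)\<^sup>2"
        proof (intro mult_left_mono power_mono)
          show "0 \<le> \<tau> (\<phi> p)" "\<tau> (\<phi> p) \<le> 2 * 2 powr i"
            using p \<tau>(2)[of "\<phi> p"] by (simp_all add: E_def)
        qed (rule nonneg)
        finally show ?thesis using True by (simp add: ennreal_leI)
      qed simp
    qed
    also have "\<dots> = ennreal (M * (2 * 2 powr i)\<^sup>2) * emeasure \<mu> (L i)"
      using L_sets by (intro nn_integral_cmult_indicator)
    also have "\<dots> \<le> ennreal (M * (2 * 2 powr i)\<^sup>2) * (ennreal (A / (2 powr i)\<^sup>2) * emeasure lborel (E i))"
      using * by (intro mult_left_mono) auto
    also have "\<dots> = ennreal (M * (2 * 2 powr i)\<^sup>2 * (A / (2 powr i)\<^sup>2)) * emeasure lborel (E i)"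
      using nonneg by (simp only: ennreal_mult zero_le_power2 mult_nonneg_nonneg divide_nonneg_nonneg mult.assoc)
    also have "M * (2 * 2 powr i)\<^sup>2 * (A / (2 powr i)\<^sup>2) = 4 * M * A"
      by (simp add: power_mult_distrib)
    finally show ?thesis .
  qed
  let ?i = "\<lambda>n. real_of_int (int_decode n)"
  have E_iff: "z \<in> E (real_of_int i) \<longleftrightarrow> z \<in> D \<and> \<lfloor>log 2 (\<tau> z)\<rfloor> = i" for z i
  proof (cases "z \<in> D")
    case True
    then have "\<tau> z > 0" by (rule \<tau>)
    then have "2 powr real_of_int i \<le> \<tau> z \<longleftrightarrow> real_of_int i \<le> log 2 (\<tau> z)"
      "\<tau> z < 2 powr (real_of_int i + 1) \<longleftrightarrow> log 2 (\<tau> z) < real_of_int i + 1"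
      by (simp_all add: le_log_iff log_less_iff)
    then show ?thesis using True by (auto simp: E_def powr_add floor_eq_iff mult.commute)
  qed (simp add: E_def)
  have disjE: "disjoint_family (\<lambda>n. E (?i n))"
    unfolding disjoint_family_on_def by (auto simp: E_iff int_decode_eq)
  then have disjL: "disjoint_family (\<lambda>n. L (?i n))"
    unfolding disjoint_family_on_def L_def by blast
  have UE: "(\<Union>n. E (?i n)) = D"
  proof -
    have "z \<in> E (?i (int_encode \<lfloor>log 2 (\<tau> z)\<rfloor>))" if "z \<in> D" for z
      using that by (simp add: E_iff)
    then show ?thesis using E_def by blast
  qed
  then have UL: "(\<Union>n. L (?i n)) = {p \<in> U. \<phi> p \<in> D}" unfolding L_def by blast
  have "(\<integral>\<^sup>+p\<in>{p \<in> U. \<phi> p \<in> D}. ennreal \<bar>k p\<bar> \<partial>\<mu>) = (\<Sum>n. \<integral>\<^sup>+p\<in>L (?i n). ennreal \<bar>k p\<bar> \<partial>\<mu>)"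
    unfolding UL[symmetric] using k(1) L_sets disjL by (intro nn_integral_disjoint_family) auto
  also have "\<dots> \<le> (\<Sum>n. ennreal (4 * M * A) * emeasure lborel (E (?i n)))"
    by (intro suminf_le layer) auto
  also have "\<dots> = ennreal (4 * M * A) * emeasure lborel D"
    using suminf_emeasure[OF _ disjE, of lborel] E_sets UE by (auto simp: image_subset_iff)
  also have "\<dots> < \<infinity>"
    using emeasure_bounded_finite[OF D(2)] by (simp add: ennreal_mult_less_top)
  finally show ?thesis .
qed

section \<open>Charts of a cone-like end\<close>

lemma open_half_space_vec_nth: "open {z :: real^'n. z $ i > c}"
  by (intro open_Collect_less continuous_intros)

lemma chart_facts:
  assumes "is_chart X (U, \<phi>)"
  shows "openin X U" "openin (top_of_set half_plane) (\<phi> ` U)" "inj_on \<phi> U"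
    "homeomorphic_map (subtopology X U) (top_of_set (\<phi> ` U)) \<phi>"
proof -
  show *: "openin X U" "openin (top_of_set half_plane) (\<phi> ` U)"
    "homeomorphic_map (subtopology X U) (top_of_set (\<phi> ` U)) \<phi>"
    using assms by (auto simp: is_chart_def)
  show "inj_on \<phi> U"
    using homeomorphic_imp_injective_map[OF *(3)] openin_subset[OF *(1)]
    by (simp add: Int_absorb1 topspace_subtopology)
qed

lemma chart_preimage_open:
  assumes "is_chart X (U, \<phi>)" "open B"
  shows "openin X {p \<in> U. \<phi> p \<in> B}"
proof -
  note c = chart_facts[OF assms(1)]
  have "continuous_map (subtopology X U) euclidean \<phi>"
    using homeomorphic_imp_continuous_map[OF c(4)] by (simp add: continuous_map_in_subtopology)
  then have "openin (subtopology X U) {p \<in> topspace (subtopology X U). \<phi> p \<in> B}"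
    by (rule openin_continuous_map_preimage) (use assms(2) in simp)
  moreover have "topspace (subtopology X U) = U"
    using openin_subset[OF c(1)] by (simp add: Int_absorb1 topspace_subtopology)
  ultimately show ?thesis using c(1) by (metis openin_open_subtopology)
qed

lemma chart_image_openin:
  assumes "is_chart X (U, \<phi>)" "openin X V" "V \<subseteq> U"
  shows "openin (top_of_set half_plane) (\<phi> ` V)"
proof -
  note c = chart_facts[OF assms(1)]
  have "openin (subtopology X U) V" using assms c by (simp add: openin_open_subtopology)
  then have "openin (top_of_set (\<phi> ` U)) (\<phi> ` V)"
    using homeomorphic_imp_open_map[OF c(4)] by (simp add: open_map_def)
  then show ?thesis using c(2) openin_trans by blast
qed

lemma half_plane_C2_extension:
  assumes "openin (top_of_set half_plane) S" "C2_on S g" "y \<in> S"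
  obtains V h h' h'' where "C2_derivs V h h' h''" "y \<in> V" "V \<inter> half_plane \<subseteq> S"
    "\<And>z. z \<in> V \<inter> half_plane \<Longrightarrow> g z = h z"
proof -
  obtain W where W: "open W" "S = half_plane \<inter> W"
    using assms(1) by (auto simp: openin_open)
  obtain V h h' h'' where V: "C2_derivs V h h' h''" "y \<in> V" "\<And>z. z \<in> S \<inter> V \<Longrightarrow> g z = h z"
    using bspec[OF assms(2)[unfolded C2_on_def] assms(3)] unfolding C2_derivs_def by blast
  have "C2_derivs (V \<inter> W) h h' h''"
    using V(1) W(1) C2_derivsD(1)[OF V(1)] by (auto intro: C2_derivs_subset)
  then show ?thesis using that[of "V \<inter> W" h h' h''] V W assms(3) by auto
qed

lemma half_plane_C2_extension_interior:
  assumes "openin (top_of_set half_plane) S" "C2_on S g" "y \<in> S" "y$2 > 0"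
  obtains V h h' h'' where "C2_derivs V h h' h''" "y \<in> V" "V \<subseteq> S" "V \<subseteq> {z. z$2 > 0}"
    "\<And>z. z \<in> V \<Longrightarrow> g z = h z"
proof -
  obtain V h h' h'' where V: "C2_derivs V h h' h''" "y \<in> V" "V \<inter> half_plane \<subseteq> S"
    "\<And>z. z \<in> V \<inter> half_plane \<Longrightarrow> g z = h z"
    using half_plane_C2_extension[OF assms(1-3)] by blast
  let ?V = "V \<inter> {z. z$2 > 0}"
  have sub: "?V \<subseteq> V \<inter> half_plane" by (auto simp: half_plane_def)
  have "C2_derivs ?V h h' h''"
    using V(1) C2_derivsD(1)[OF V(1)] open_half_space_vec_nth by (auto intro: C2_derivs_subset)
  then show ?thesis
    using that[of ?V h h' h''] V(2-4) sub assms(4) by blast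
qed

lemma half_plane_derivative_unique:
  assumes S: "openin (top_of_set half_plane) S" and C2: "C2_derivs V h h' h''"
    and y: "y \<in> V" "V \<inter> half_plane \<subseteq> S" "\<And>z. z \<in> V \<inter> half_plane \<Longrightarrow> g z = h z" "y \<in> half_plane"
    and D: "(g has_derivative D) (at y within S)"
  shows "D = h' y"
proof (rule frechet_derivative_unique_within[OF D])
  note d = C2_derivsD[OF C2]
  obtain e where e: "e > 0" "ball y e \<subseteq> V" using d(1) y open_contains_ball by blast
  have Sh: "S \<subseteq> half_plane" using S openin_imp_subset by blast
  show "(g has_derivative h' y) (at y within S)"
  proof (rule has_derivative_transform_within[OF has_derivative_at_withinI[OF d(2)[OF y(1)]] e(1)])
    show "h z = g z" if "z \<in> S" "dist z y < e" for z
    proof -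
      have "z \<in> V \<inter> half_plane" using that e(2) Sh by (auto simp: dist_commute)
      then show ?thesis by (simp add: y(3))
    qed
  qed (use y in auto)
  fix i :: "real^2" and r :: real assume i: "i \<in> Basis" and r: "r > 0"
  define t where "t = min r e / 2"
  have t: "t > 0" "t < r" "t < e" using r e by (auto simp: t_def min_def)
  have "i$2 \<ge> 0" using i by (auto simp: Basis_vec_def axis_def)
  then have "y + t *\<^sub>R i \<in> half_plane" using y(4) t by (simp add: half_plane_def)
  moreover have "y + t *\<^sub>R i \<in> V"
    using i t by (intro subsetD[OF e(2)]) (simp add: dist_norm)
  ultimately show "\<exists>t. 0 < \<bar>t\<bar> \<and> \<bar>t\<bar> < r \<and> y + t *\<^sub>R i \<in> S"
    using t y(2) by (intro exI[of _ t]) auto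
qed

locale cone_like_surface =
  fixes X :: "'a topology" and A :: "'a chart set" and f :: "'a \<Rightarrow> real^3"
  assumes cone: "cone_like_ends X A f"
begin

lemma chart: "(U, \<phi>) \<in> A \<Longrightarrow> is_chart X (U, \<phi>)"
  using cone by (auto simp: cone_like_ends_def C2_surface_with_boundary_def)

lemma boundaryI: "(U, \<phi>) \<in> A \<Longrightarrow> p \<in> U \<Longrightarrow> \<phi> p $ 2 = 0 \<Longrightarrow> p \<in> surface_boundary X A"
  using openin_subset[OF chart_facts(1)[OF chart]] by (auto simp: surface_boundary_def)

lemma image_half_plane:
  assumes "(U, \<phi>) \<in> A" "p \<in> U"
  shows "\<phi> p \<in> half_plane"
  using openin_imp_subset[OF chart_facts(2)[OF chart[OF assms(1)]]] assms(2) by blast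

lemma interior_pos:
  assumes "(U, \<phi>) \<in> A" "p \<in> U" "p \<in> surface_interior X A"
  shows "\<phi> p $ 2 > 0"
proof -
  have "\<phi> p $ 2 \<noteq> 0" using boundaryI[OF assms(1,2)] assms(3) by (auto simp: surface_interior_def)
  then show ?thesis using image_half_plane[OF assms(1,2)] by (simp add: half_plane_def)
qed

lemma height_interior: "p \<in> surface_interior X A \<Longrightarrow> f p $ 3 > 0"
  using cone unfolding cone_like_ends_def hyperbolic_space_def by blast

lemma height_boundary: "p \<in> surface_boundary X A \<Longrightarrow> f p $ 3 = 0"
  using cone unfolding cone_like_ends_def by blast

lemma height_nonneg: "p \<in> topspace X \<Longrightarrow> f p $ 3 \<ge> 0"
  using height_interior[of p] height_boundary[of p]
  by (cases "p \<in> surface_boundary X A") (auto simp: surface_interior_def)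

lemma local_rep_chart:
  assumes "(U, \<phi>) \<in> A" "p \<in> U"
  shows "local_rep f (U, \<phi>) (\<phi> p) = f p"
  using chart_facts(3)[OF chart[OF assms(1)]] assms(2) by (simp add: local_rep_def)

lemma immersion_chart:
  assumes "(U, \<phi>) \<in> A"
  shows "C2_on (\<phi> ` U) (local_rep f (U, \<phi>)) \<and>
     (\<forall>y\<in>\<phi> ` U. \<exists>D. (local_rep f (U, \<phi>) has_derivative D) (at y within \<phi> ` U) \<and> inj D)"
proof -
  have "C2_immersion A f" using cone by (simp add: cone_like_ends_def)
  from bspec[OF this[unfolded C2_immersion_def] assms] show ?thesis unfolding prod.case .
qed

lemma transition_C2:
  assumes "(U, \<phi>) \<in> A" "(V, \<psi>) \<in> A"
  shows "C2_on (\<phi> ` (U \<inter> V)) (\<psi> \<circ> inv_into U \<phi>)"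
proof -
  have "\<forall>(U, \<phi>)\<in>A. \<forall>(V, \<psi>)\<in>A. C2_on (\<phi> ` (U \<inter> V)) (\<psi> \<circ> inv_into U \<phi>)"
    using cone by (simp add: cone_like_ends_def C2_surface_with_boundary_def)
  from bspec[OF this assms(1), unfolded prod.case, THEN bspec, OF assms(2)] show ?thesis
    unfolding prod.case .
qed

lemma local_rep_C2: "(U, \<phi>) \<in> A \<Longrightarrow> C2_on (\<phi> ` U) (local_rep f (U, \<phi>))"
  using immersion_chart by blast

definition adapted :: "'a set \<Rightarrow> ('a \<Rightarrow> real^2) \<Rightarrow> (real^2) set \<Rightarrow> (real^2 \<Rightarrow> real^3) \<Rightarrow>
    (real^2 \<Rightarrow> (real^2) \<Rightarrow>\<^sub>L (real^3)) \<Rightarrow> (real^2 \<Rightarrow> (real^2) \<Rightarrow>\<^sub>L (real^2) \<Rightarrow>\<^sub>L (real^3)) \<Rightarrow> bool" where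
  "adapted U \<phi> V h h' h'' \<longleftrightarrow> (U, \<phi>) \<in> A \<and> C2_derivs V h h' h'' \<and> V \<inter> half_plane \<subseteq> \<phi> ` U \<and>
     (\<forall>z\<in>V \<inter> half_plane. local_rep f (U, \<phi>) z = h z)"

lemma adapted_exists:
  assumes "(U, \<phi>) \<in> A" "p \<in> U"
  obtains V h h' h'' where "adapted U \<phi> V h h' h''" "\<phi> p \<in> V"
proof (rule half_plane_C2_extension[OF chart_facts(2)[OF chart[OF assms(1)]] local_rep_C2[OF assms(1)]
      imageI[OF assms(2)]])
  fix V h h' h''
  assume "C2_derivs V h h' h''" "\<phi> p \<in> V" "V \<inter> half_plane \<subseteq> \<phi> ` U"
    "\<And>z. z \<in> V \<inter> half_plane \<Longrightarrow> local_rep f (U, \<phi>) z = h z"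
  then show thesis
    using assms(1) by (intro that[of V h h' h'']) (simp_all add: adapted_def)
qed

lemma adapted_derivative:
  assumes "adapted U \<phi> V h h' h''" "z \<in> V" "z \<in> half_plane"
  obtains "(local_rep f (U, \<phi>) has_derivative blinfun_apply (h' z)) (at z within \<phi> ` U)"
    "inj (blinfun_apply (h' z))"
proof -
  have a: "(U, \<phi>) \<in> A" "C2_derivs V h h' h''" "V \<inter> half_plane \<subseteq> \<phi> ` U"
    "\<And>z. z \<in> V \<inter> half_plane \<Longrightarrow> local_rep f (U, \<phi>) z = h z"
    using assms(1) unfolding adapted_def by auto
  have "z \<in> \<phi> ` U" using a assms by blast
  then obtain D where D: "(local_rep f (U, \<phi>) has_derivative D) (at z within \<phi> ` U)" "inj D"
    using immersion_chart[OF a(1)] by blast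
  have "D = h' z"
    using half_plane_derivative_unique[OF chart_facts(2)[OF chart[OF a(1)]] a(2) assms(2) a(3) _ assms(3) D(1)]
      a(4) by blast
  then show ?thesis using that D by blast
qed

lemma adapted_conormal:
  assumes "adapted U \<phi> V h h' h''" "z \<in> V" "z \<in> half_plane"
  shows "conormal h' z \<noteq> 0"
  using adapted_derivative[OF assms] cross_inj_ne_0 unfolding conormal_def
  by (metis blinfun.bounded_linear_right bounded_linear.linear)

lemma adapted_point:
  assumes "adapted U \<phi> V h h' h''" "z \<in> V" "z \<in> half_plane"
  obtains p where "p \<in> U" "z = \<phi> p" "h z = f p" "p \<in> topspace X"
proof -
  have a: "(U, \<phi>) \<in> A" using assms(1) unfolding adapted_def by auto
  obtain p where p: "p \<in> U" "z = \<phi> p" using assms unfolding adapted_def by blast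
  then have "h z = f p" using assms local_rep_chart[OF a p(1)] unfolding adapted_def by simp
  moreover have "p \<in> topspace X" using p openin_subset[OF chart_facts(1)[OF chart[OF a]]] by blast
  ultimately show ?thesis using that p by blast
qed

lemma adapted_boundary:
  assumes a: "adapted U \<phi> V h h' h''" "\<phi> p \<in> V" and p: "p \<in> U" "p \<in> surface_boundary X A"
  shows "h (\<phi> p) $ 3 = 0" "conormal h' (\<phi> p) $ 3 = 0"
proof -
  have UA: "(U, \<phi>) \<in> A" and C2: "C2_derivs V h h' h''" using a(1) unfolding adapted_def by auto
  note hp = image_half_plane[OF UA p(1)]
  show h0: "h (\<phi> p) $ 3 = 0"
    using height_boundary[OF p(2)] a local_rep_chart[OF UA p(1)] hp unfolding adapted_def by simp
  have "conormal h' (\<phi> p) \<bullet> h' (\<phi> p) v = 0" for v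
    using conormal_orthogonal by (metis inner_commute)
  moreover obtain "(local_rep f (U, \<phi>) has_derivative blinfun_apply (h' (\<phi> p))) (at (\<phi> p) within \<phi> ` U)"
    by (rule adapted_derivative[OF a hp])
  moreover have "\<forall>p\<in>U \<inter> surface_boundary X A. \<forall>D n.
        (local_rep f (U, \<phi>) has_derivative D) (at (\<phi> p) within \<phi> ` U) \<longrightarrow>
        (\<forall>v. n \<bullet> D v = 0) \<longrightarrow> n \<bullet> axis 3 1 = 0"
  proof -
    have "orthogonal_along_boundary X A f" using cone by (simp add: cone_like_ends_def)
    from bspec[OF this[unfolded orthogonal_along_boundary_def] UA] show ?thesis unfolding prod.case .
  qed
  ultimately have "conormal h' (\<phi> p) \<bullet> axis 3 1 = 0"
    using p by blast
  then show "conormal h' (\<phi> p) $ 3 = 0" by (simp add: inner_axis)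
qed

text \<open>At a boundary point with \<open>\<phi> p $ 2 > 0\<close> the height would have a local minimum, making the
  tangent plane horizontal, against orthogonality. So charts agree on what the boundary is, without
  invariance of domain.\<close>

lemma adapted_interior:
  assumes a: "adapted U \<phi> V h h' h''" "\<phi> p \<in> V" and p: "p \<in> U" "\<phi> p $ 2 > 0"
  shows "p \<in> surface_interior X A" "h (\<phi> p) $ 3 > 0"
proof -
  have UA: "(U, \<phi>) \<in> A" and C2: "C2_derivs V h h' h''" using a(1) unfolding adapted_def by auto
  note d = C2_derivsD[OF C2] and hp = image_half_plane[OF UA p(1)]
  have pX: "p \<in> topspace X" using p openin_subset[OF chart_facts(1)[OF chart[OF UA]]] by blast
  have "p \<notin> surface_boundary X A"
  proof
    assume b: "p \<in> surface_boundary X A"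
    note ab = adapted_boundary[OF a p(1) b]
    have "open (V \<inter> {z. z$2 > 0})" using d(1) open_half_space_vec_nth by blast
    then obtain e where e: "e > 0" "ball (\<phi> p) e \<subseteq> V \<inter> {z. z$2 > 0}"
      using a(2) p(2) open_contains_ball by blast
    have nonneg: "h z $ 3 \<ge> 0" if "z \<in> ball (\<phi> p) e" for z
    proof -
      have "z \<in> V" "z \<in> half_plane" using that e(2) by (auto simp: half_plane_def)
      then show ?thesis using adapted_point[OF a(1)] height_nonneg by metis
    qed
    have "((\<lambda>z. h z $ 3) has_derivative (\<lambda>u. h' (\<phi> p) u $ 3)) (at (\<phi> p))"
      by (rule bounded_linear.has_derivative[OF bounded_linear_vec_nth d(2)[OF a(2)]])
    then have "(\<lambda>u. h' (\<phi> p) u $ 3) = (\<lambda>u. 0)"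
      using differential_zero_maxmin[of "\<phi> p" "ball (\<phi> p) e" "\<lambda>z. h z $ 3"] e(1) nonneg ab(1) by auto
    then have "h' (\<phi> p) u $ 3 = 0" for u by meson
    then have "conormal h' (\<phi> p) = 0"
      using ab(2) unfolding vec_eq_iff forall_3 by (simp add: conormal_def cross_components)
    then show False using adapted_conormal[OF a hp] by blast
  qed
  then show i: "p \<in> surface_interior X A" using pX by (simp add: surface_interior_def)
  show "h (\<phi> p) $ 3 > 0"
    using height_interior[OF i] a local_rep_chart[OF UA p(1)] hp unfolding adapted_def by simp
qed

lemma extrinsic_curvature_chart:
  assumes a: "adapted U \<phi> V h h' h''" "\<phi> p \<in> V" and p: "p \<in> U" "\<phi> p $ 2 > 0"
  shows "extrinsic_curvature hyperbolic_metric A f p = chart_curvature h h' h'' (\<phi> p)"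
proof -
  have UA: "(U, \<phi>) \<in> A" and C2: "C2_derivs V h h' h''" using a(1) unfolding adapted_def by auto
  note hp = image_half_plane[OF UA p(1)]
  note pi = adapted_interior[OF a p]
  note ne = adapted_conormal[OF a hp]
  define V0 where "V0 = V \<inter> {z. z$2 > 0}"
  have V0h: "V0 \<subseteq> V \<inter> half_plane" by (auto simp: V0_def half_plane_def)
  have C0: "C2_derivs V0 h h' h''"
    unfolding V0_def
    by (rule C2_derivs_subset[OF C2]) (auto intro!: open_Int C2_derivsD(1)[OF C2] open_half_space_vec_nth)
  have p0: "\<phi> p \<in> V0" using a(2) p(2) by (simp add: V0_def)
  have F: "\<And>z. z \<in> V0 \<Longrightarrow> local_rep f (U, \<phi>) z = h z"
    using a(1) V0h unfolding adapted_def by blast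
  show ?thesis
    unfolding extrinsic_curvature_def
  proof (rule the_equality)
    obtain N k1 k2 where N: "unit_normal hyperbolic_metric (local_rep f (U, \<phi>)) (\<phi> p) N"
      "principal_curvatures hyperbolic_metric (local_rep f (U, \<phi>)) (\<phi> p) N k1 k2"
      using principal_curvatures_exist[OF C0 p0 F pi(2) ne] by blast
    moreover have "k1 * k2 = chart_curvature h h' h'' (\<phi> p)"
      using principal_curvatures_product[OF C0 p0 F pi(2) ne N] by blast
    ultimately have "\<exists>N k1 k2. p \<in> U \<and> unit_normal hyperbolic_metric (local_rep f (U, \<phi>)) (\<phi> p) N \<and>
        principal_curvatures hyperbolic_metric (local_rep f (U, \<phi>)) (\<phi> p) N k1 k2 \<and>
        chart_curvature h h' h'' (\<phi> p) = k1 * k2"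
      using p(1) by metis
    then show "\<exists>(W, \<psi>)\<in>A. \<exists>N k1 k2. p \<in> W \<and> unit_normal hyperbolic_metric (local_rep f (W, \<psi>)) (\<psi> p) N \<and>
        principal_curvatures hyperbolic_metric (local_rep f (W, \<psi>)) (\<psi> p) N k1 k2 \<and>
        chart_curvature h h' h'' (\<phi> p) = k1 * k2"
      using UA by (intro bexI[of _ "(U, \<phi>)"]) (unfold prod.case)
  next
    fix K assume "\<exists>(U, \<phi>)\<in>A. \<exists>N k1 k2. p \<in> U \<and> unit_normal hyperbolic_metric (local_rep f (U, \<phi>)) (\<phi> p) N \<and>
        principal_curvatures hyperbolic_metric (local_rep f (U, \<phi>)) (\<phi> p) N k1 k2 \<and> K = k1 * k2"
    then obtain W \<psi> N k1 k2 where W: "(W, \<psi>) \<in> A" "p \<in> W"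
      and N: "unit_normal hyperbolic_metric (local_rep f (W, \<psi>)) (\<psi> p) N"
      and k: "principal_curvatures hyperbolic_metric (local_rep f (W, \<psi>)) (\<psi> p) N k1 k2"
      and K: "K = k1 * k2" by blast
    have pos: "\<psi> p $ 2 > 0" using interior_pos[OF W pi(1)] .
    note injW = chart_facts(3)[OF chart[OF W(1)]] and injU = chart_facts(3)[OF chart[OF UA]]
    obtain V1 g g' g'' where a1: "adapted W \<psi> V1 g g' g''" "\<psi> p \<in> V1"
      using adapted_exists[OF W] by blast
    have C1: "C2_derivs V1 g g' g''" using a1 unfolding adapted_def by auto
    have "openin X (W \<inter> U)"
      using chart_facts(1)[OF chart[OF W(1)]] chart_facts(1)[OF chart[OF UA]] by blast
    then have "openin (top_of_set half_plane) (\<psi> ` (W \<inter> U))"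
      using chart_image_openin[OF chart[OF W(1)]] by blast
    moreover have "C2_on (\<psi> ` (W \<inter> U)) (\<phi> \<circ> inv_into W \<psi>)"
      by (rule transition_C2[OF W(1) UA])
    moreover have "\<psi> p \<in> \<psi> ` (W \<inter> U)" using W p by blast
    ultimately obtain V2 t t' t'' where V2: "C2_derivs V2 t t' t''" "\<psi> p \<in> V2" "V2 \<subseteq> \<psi> ` (W \<inter> U)"
      "V2 \<subseteq> {z. z$2 > 0}" "\<And>z. z \<in> V2 \<Longrightarrow> (\<phi> \<circ> inv_into W \<psi>) z = t z"
      using half_plane_C2_extension_interior pos by blast
    define V3 where "V3 = (V2 \<inter> t -` V0) \<inter> V1"
    have op3: "open V3"
      unfolding V3_def
      by (intro open_Int continuous_open_preimage C2_derivs_continuous(1)[OF V2(1)]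
          C2_derivsD(1)[OF V2(1)] C2_derivsD(1)[OF C0] C2_derivsD(1)[OF C1])
    have t_eq: "t (\<psi> q) = \<phi> q" if "q \<in> W" "\<psi> q \<in> V2" for q
      using V2(5)[OF that(2)] injW that(1) by simp
    have in3: "\<psi> p \<in> V3" using V2(2) a1(2) p0 t_eq[OF W(2) V2(2)] by (simp add: V3_def)
    have G: "local_rep f (W, \<psi>) z = g z" if "z \<in> V3" for z
      using that a1(1) V2(4) unfolding adapted_def V3_def by (auto simp: half_plane_def)
    have gh: "g z = h (t z)" if z: "z \<in> V3" for z
    proof -
      obtain q where q: "q \<in> W" "q \<in> U" "z = \<psi> q" using z V2(3) unfolding V3_def by blast
      have "t z = \<phi> q" using t_eq q z unfolding V3_def by blast
      moreover have "t z \<in> V0" using z by (simp add: V3_def)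
      ultimately have "h (t z) = f q" using F local_rep_chart[OF UA q(2)] by metis
      moreover have "g z = f q" using G[OF z] local_rep_chart[OF W(1) q(1)] q(3) by simp
      ultimately show ?thesis by simp
    qed
    have g3: "g (\<psi> p) $ 3 > 0" using gh[OF in3] t_eq[OF W(2) V2(2)] pi(2) by simp
    obtain inj: "inj (blinfun_apply (g' (\<psi> p)))"
      using adapted_derivative[OF a1 image_half_plane[OF W]] by blast
    have C13: "C2_derivs V3 g g' g''" and C23: "C2_derivs V3 t t' t''"
      using C2_derivs_subset[OF C1 op3] C2_derivs_subset[OF V2(1) op3] by (auto simp: V3_def)
    have tV: "t z \<in> V0" if "z \<in> V3" for z using that by (simp add: V3_def)
    have "unit_normal hyperbolic_metric (local_rep f (U, \<phi>)) (\<phi> p) N"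
      "principal_curvatures hyperbolic_metric (local_rep f (U, \<phi>)) (\<phi> p) N k1 k2"
      using principal_curvatures_reparametrize[OF C13 C0 C23 tV gh in3 G F inj g3 N k]
      unfolding t_eq[OF W(2) V2(2)] by blast+
    then show "K = chart_curvature h h' h'' (\<phi> p)"
      using principal_curvatures_product[OF C0 p0 F pi(2) ne] K by blast
  qed
qed

section \<open>Integrability\<close>

lemma topspace_chart:
  assumes "p \<in> topspace X"
  obtains U \<phi> where "(U, \<phi>) \<in> A" "p \<in> U"
proof -
  have "(\<Union>c\<in>A. fst c) = topspace X"
    using cone by (simp add: cone_like_ends_def C2_surface_with_boundary_def)
  then obtain c where "c \<in> A" "p \<in> fst c" using assms by blast
  then show ?thesis using that[of "fst c" "snd c"] by simp
qed

lemma interior_iff: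
  assumes "(U, \<phi>) \<in> A" "p \<in> U"
  shows "p \<in> surface_interior X A \<longleftrightarrow> \<phi> p $ 2 > 0"
proof
  assume "\<phi> p $ 2 > 0"
  moreover obtain V h h' h'' where "adapted U \<phi> V h h' h''" "\<phi> p \<in> V"
    by (rule adapted_exists[OF assms])
  ultimately show "p \<in> surface_interior X A" using adapted_interior assms(2) by blast
qed (rule interior_pos[OF assms])

lemma curvature_chart_bound:
  assumes "p \<in> topspace X"
  obtains U \<phi> r V h h' h'' M B where "p \<in> U" "adapted U \<phi> V h h' h''" "r > 0" "ball (\<phi> p) r \<subseteq> V" "M \<ge> 0" "B \<ge> 0"
    "\<And>z. z \<in> ball (\<phi> p) r \<Longrightarrow> conormal h' z \<noteq> 0"
    "\<And>z. z \<in> ball (\<phi> p) r \<Longrightarrow> norm (conormal h' z) \<le> B"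
    "\<And>z. z \<in> ball (\<phi> p) r \<Longrightarrow> z$2 > 0 \<Longrightarrow> \<bar>chart_curvature h h' h'' z\<bar> \<le> M * (h z $ 3)\<^sup>2"
proof -
  obtain U \<phi> where U: "(U, \<phi>) \<in> A" "p \<in> U" using topspace_chart[OF assms] .
  obtain V h h' h'' where a: "adapted U \<phi> V h h' h''" "\<phi> p \<in> V" by (rule adapted_exists[OF U])
  have C2: "C2_derivs V h h' h''" using a(1) by (simp add: adapted_def)
  have bd: "h z $ 3 = 0 \<and> conormal h' z $ 3 = 0" if z: "z \<in> V" "z$2 = 0" for z
  proof -
    have "z \<in> half_plane" using z by (simp add: half_plane_def)
    then obtain q where q: "q \<in> U" "z = \<phi> q" using adapted_point[OF a(1) z(1)] by blast
    then show ?thesis using adapted_boundary[OF a(1) _ q(1)] boundaryI[OF U(1) q(1)] z by simp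
  qed
  have pos: "h z $ 3 > 0" if z: "z \<in> V" "z$2 > 0" for z
  proof -
    have "z \<in> half_plane" using z by (simp add: half_plane_def)
    then obtain q where q: "q \<in> U" "z = \<phi> q" using adapted_point[OF a(1) z(1)] by blast
    then show ?thesis using adapted_interior(2)[OF a(1) _ q(1)] z by simp
  qed
  have half: "\<phi> p $ 2 \<ge> 0" using image_half_plane[OF U] by (simp add: half_plane_def)
  show ?thesis
  proof (rule chart_curvature_height_bound[OF C2 a(2) adapted_conormal[OF a image_half_plane[OF U]] bd pos half])
    fix r M B
    assume "0 < r" "ball (\<phi> p) r \<subseteq> V" "0 \<le> M" "0 \<le> B"
      "\<And>z. z \<in> ball (\<phi> p) r \<Longrightarrow> conormal h' z \<noteq> 0"
      "\<And>z. z \<in> ball (\<phi> p) r \<Longrightarrow> norm (conormal h' z) \<le> B"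
      "\<And>z. z \<in> ball (\<phi> p) r \<Longrightarrow> z$2 > 0 \<Longrightarrow> \<bar>chart_curvature h h' h'' z\<bar> \<le> M * (h z $ 3)\<^sup>2"
    then show thesis by (rule that[OF U(2) a(1)])
  qed
qed

lemma openin_interior_sets:
  assumes "is_area_measure G X A f \<mu>" "openin X S" "S \<subseteq> surface_interior X A"
  shows "S \<in> sets \<mu>"
proof -
  have "openin (subtopology X (surface_interior X A)) S"
    unfolding openin_subtopology using assms(2,3) by blast
  then show ?thesis using assms(1) by (auto simp: is_area_measure_def)
qed

lemma extrinsic_curvature_measurable:
  assumes \<mu>: "is_area_measure G X A f \<mu>"
  shows "extrinsic_curvature hyperbolic_metric A f \<in> borel_measurable \<mu>"
proof (rule borel_measurableI)
  let ?K = "extrinsic_curvature hyperbolic_metric A f"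
  fix T :: "real set" assume T: "open T"
  have sp: "space \<mu> = surface_interior X A" using \<mu> by (simp add: is_area_measure_def)
  have "openin X (?K -` T \<inter> surface_interior X A)"
  proof (subst openin_subopen, intro ballI)
    fix p assume p: "p \<in> ?K -` T \<inter> surface_interior X A"
    then have "p \<in> topspace X" by (simp add: surface_interior_def)
    then obtain U \<phi> r V h h' h'' M B where *: "p \<in> U" "adapted U \<phi> V h h' h''" "r > 0" "ball (\<phi> p) r \<subseteq> V"
      "M \<ge> 0" "B \<ge> 0" "\<And>z. z \<in> ball (\<phi> p) r \<Longrightarrow> conormal h' z \<noteq> 0"
      "\<And>z. z \<in> ball (\<phi> p) r \<Longrightarrow> norm (conormal h' z) \<le> B"
      "\<And>z. z \<in> ball (\<phi> p) r \<Longrightarrow> z$2 > 0 \<Longrightarrow> \<bar>chart_curvature h h' h'' z\<bar> \<le> M * (h z $ 3)\<^sup>2"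
      by (rule curvature_chart_bound) (rule that)
    have UA: "(U, \<phi>) \<in> A" and C2: "C2_derivs V h h' h''" using *(2) by (simp_all add: adapted_def)
    define D where "D = ball (\<phi> p) r \<inter> {z. z$2 > 0}"
    have oD: "open D" unfolding D_def using open_half_space_vec_nth by blast
    have DV: "D \<subseteq> V" using *(4) by (auto simp: D_def)
    have "continuous_on D (chart_curvature h h' h'')"
      by (rule chart_curvature_continuous_on[OF C2_derivs_subset[OF C2 oD DV]]) (simp add: *(7) D_def)
    then have oT: "open (D \<inter> chart_curvature h h' h'' -` T)"
      using oD T by (rule continuous_open_preimage)
    let ?S = "{q \<in> U. \<phi> q \<in> D \<inter> chart_curvature h h' h'' -` T}"
    have K: "q \<in> surface_interior X A \<and> ?K q = chart_curvature h h' h'' (\<phi> q)" if "q \<in> U" "\<phi> q \<in> D" for q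
      using adapted_interior(1)[OF *(2) _ that(1)] extrinsic_curvature_chart[OF *(2) _ that(1)] that DV
      by (auto simp: D_def)
    have "openin X ?S" by (rule chart_preimage_open[OF chart[OF UA] oT])
    moreover have "\<phi> p \<in> D" using *(3) interior_pos[OF UA *(1)] p by (simp add: D_def)
    then have "p \<in> ?S" using K[OF *(1)] p *(1) by simp
    moreover have "?S \<subseteq> ?K -` T \<inter> surface_interior X A" using K by auto
    ultimately show "\<exists>S. openin X S \<and> p \<in> S \<and> S \<subseteq> ?K -` T \<inter> surface_interior X A" by blast
  qed
  then show "?K -` T \<inter> space \<mu> \<in> sets \<mu>"
    unfolding sp using openin_interior_sets[OF \<mu>] by blast
qed

lemma curvature_locally_integrable:
  assumes \<mu>: "is_area_measure hyperbolic_metric X A f \<mu>" and p: "p \<in> topspace X"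
  obtains W where "openin X W" "p \<in> W" "W \<inter> surface_interior X A \<in> sets \<mu>"
    "(\<integral>\<^sup>+q\<in>W \<inter> surface_interior X A. ennreal \<bar>extrinsic_curvature hyperbolic_metric A f q\<bar> \<partial>\<mu>) < \<infinity>"
proof -
  let ?K = "extrinsic_curvature hyperbolic_metric A f"
  obtain U \<phi> r V h h' h'' M B where *: "p \<in> U" "adapted U \<phi> V h h' h''" "r > 0" "ball (\<phi> p) r \<subseteq> V"
    and nonneg: "M \<ge> 0" "B \<ge> 0"
    and ne: "\<And>z. z \<in> ball (\<phi> p) r \<Longrightarrow> conormal h' z \<noteq> 0"
    and B: "\<And>z. z \<in> ball (\<phi> p) r \<Longrightarrow> norm (conormal h' z) \<le> B"
    and M: "\<And>z. z \<in> ball (\<phi> p) r \<Longrightarrow> z$2 > 0 \<Longrightarrow> \<bar>chart_curvature h h' h'' z\<bar> \<le> M * (h z $ 3)\<^sup>2"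
    by (rule curvature_chart_bound[OF p]) (rule that)
  have UA: "(U, \<phi>) \<in> A" and C2: "C2_derivs V h h' h''" and sub: "V \<inter> half_plane \<subseteq> \<phi> ` U"
    and rep: "\<And>z. z \<in> V \<inter> half_plane \<Longrightarrow> local_rep f (U, \<phi>) z = h z"
    using *(2) by (simp_all add: adapted_def)
  define D where "D = ball (\<phi> p) r \<inter> {z. z$2 > 0}"
  have oD: "open D" unfolding D_def using open_half_space_vec_nth by blast
  have DV: "D \<subseteq> V \<inter> half_plane" using *(4) by (auto simp: D_def half_plane_def)
  have DU: "D \<subseteq> \<phi> ` U" using DV sub by blast
  have CD: "C2_derivs D h h' h''" using C2_derivs_subset[OF C2 oD] DV by blast
  have int: "q \<in> surface_interior X A" "h (\<phi> q) $ 3 > 0" "?K q = chart_curvature h h' h'' (\<phi> q)"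
    if "q \<in> U" "\<phi> q \<in> D" for q
    using adapted_interior[OF *(2) _ that(1)] extrinsic_curvature_chart[OF *(2) _ that(1)] that DV
    by (auto simp: D_def)
  have hD: "h z $ 3 > 0" if "z \<in> D" for z
    using DU int(2) that by blast
  have inter: "{q \<in> U. \<phi> q \<in> ball (\<phi> p) r} \<inter> surface_interior X A = {q \<in> U. \<phi> q \<in> D}"
    using interior_iff[OF UA] by (auto simp: D_def)
  have pre_sets: "{q \<in> U. \<phi> q \<in> E} \<in> sets \<mu>" if "open E" "E \<subseteq> D" for E
    using chart_preimage_open[OF chart[OF UA] that(1)] int(1) that(2)
    by (intro openin_interior_sets[OF \<mu>]) auto
  have "(\<integral>\<^sup>+q\<in>{q \<in> U. \<phi> q \<in> D}. ennreal \<bar>?K q\<bar> \<partial>\<mu>) < \<infinity>"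
  proof (rule nn_integral_dyadic_layers[where \<tau> = "\<lambda>z. h z $ 3" and A = B and M = M
        and dens = "area_density hyperbolic_metric (local_rep f (U, \<phi>))"])
    show "bounded D" unfolding D_def by (intro bounded_Int) auto
    show "continuous_on D (\<lambda>z. h z $ 3)"
      by (intro continuous_intros C2_derivs_continuous[OF CD])
    show "emeasure \<mu> E = (\<integral>\<^sup>+y\<in>\<phi> ` E. ennreal (area_density hyperbolic_metric (local_rep f (U, \<phi>)) y) \<partial>lborel)"
      if "E \<in> sets \<mu>" "E \<subseteq> U" for E
    proof -
      have "\<forall>(U, \<phi>)\<in>A. \<forall>B\<in>sets \<mu>. B \<subseteq> U \<longrightarrow>
        emeasure \<mu> B = (\<integral>\<^sup>+y\<in>\<phi> ` B. ennreal (area_density hyperbolic_metric (local_rep f (U, \<phi>)) y) \<partial>lborel)"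
        using \<mu> unfolding is_area_measure_def by (elim conjE)
      from bspec[OF this UA, unfolded prod.case] that show ?thesis by blast
    qed
    show "area_density hyperbolic_metric (local_rep f (U, \<phi>)) z \<le> B / (h z $ 3)\<^sup>2" if "z \<in> D" for z
    proof -
      have "area_density hyperbolic_metric (local_rep f (U, \<phi>)) z = norm (conormal h' z) / (h z $ 3)\<^sup>2"
        by (rule area_density_hyperbolic[OF CD that _ hD[OF that]]) (use rep DV in blast)
      also have "\<dots> \<le> B / (h z $ 3)\<^sup>2"
        using B[of z] that by (intro divide_right_mono) (auto simp: D_def)
      finally show ?thesis .
    qed
    show "\<bar>?K q\<bar> \<le> M * (h (\<phi> q) $ 3)\<^sup>2" if "q \<in> U" "\<phi> q \<in> D" for q
      using M[of "\<phi> q"] int(3)[OF that] that(2) by (simp add: D_def)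
    show "?K \<in> borel_measurable \<mu>" by (rule extrinsic_curvature_measurable[OF \<mu>])
  qed (use oD DU hD pre_sets nonneg in auto)
  then show ?thesis
    using that[of "{q \<in> U. \<phi> q \<in> ball (\<phi> p) r}"] chart_preimage_open[OF chart[OF UA] open_ball]
      *(1,3) pre_sets[OF oD order_refl] unfolding inter by simp
qed

end

theorem proposition7:
  fixes X :: "'a topology" and A :: "'a chart set" and f :: "'a \<Rightarrow> real^3"
    and C :: "(real^3) set" and K :: "'a \<Rightarrow> real" and dS :: "'a measure"
  assumes "connected_cone_like_end X A f C"
    and "complete_surface hyperbolic_metric X A f"
    and "K = extrinsic_curvature hyperbolic_metric A f"
    and "is_area_measure hyperbolic_metric X A f dS"
  shows "integrable dS K"
proof -
  interpret cone_like_surface X A f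
    using assms(1) by unfold_locales (simp add: connected_cone_like_end_def)
  let ?I = "surface_interior X A"
  have meas: "K \<in> borel_measurable dS"
    unfolding assms(3) by (rule extrinsic_curvature_measurable[OF assms(4)])
  define good where "good W \<longleftrightarrow> openin X W \<and> W \<inter> ?I \<in> sets dS \<and> (\<integral>\<^sup>+q\<in>W \<inter> ?I. ennreal \<bar>K q\<bar> \<partial>dS) < \<infinity>" for W
  have cover: "topspace X \<subseteq> \<Union>(Collect good)"
  proof
    fix p assume p: "p \<in> topspace X"
    obtain W where "good W" "p \<in> W"
      by (rule curvature_locally_integrable[OF assms(4) p]) (rule that, simp_all add: good_def assms(3))
    then show "p \<in> \<Union>(Collect good)" by blast
  qed
  have opn: "\<forall>W\<in>Collect good. openin X W" by (simp add: good_def)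
  have "compact_space X" using cone by (simp add: cone_like_ends_def)
  then have "(\<forall>W\<in>Collect good. openin X W) \<and> topspace X \<subseteq> \<Union>(Collect good) \<longrightarrow>
      (\<exists>\<F>. finite \<F> \<and> \<F> \<subseteq> Collect good \<and> topspace X \<subseteq> \<Union>\<F>)"
    unfolding compact_space_alt by (rule spec)
  from mp[OF this conjI[OF opn cover]] obtain \<F> where \<F>: "finite \<F>" "\<F> \<subseteq> Collect good" "topspace X \<subseteq> \<Union>\<F>"
    by (elim exE conjE)
  have space: "space dS = ?I" using assms(4) by (simp add: is_area_measure_def)
  have "(\<integral>\<^sup>+q. ennreal (norm (K q)) \<partial>dS) \<le> (\<integral>\<^sup>+q. (\<Sum>W\<in>\<F>. ennreal \<bar>K q\<bar> * indicator (W \<inter> ?I) q) \<partial>dS)"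
  proof (rule nn_integral_mono)
    fix q assume "q \<in> space dS"
    then have q: "q \<in> ?I" by (simp add: space)
    then obtain W where W: "W \<in> \<F>" "q \<in> W" using \<F>(3) by (auto simp: surface_interior_def)
    have "ennreal (norm (K q)) = ennreal \<bar>K q\<bar> * indicator (W \<inter> ?I) q" using q W by simp
    also have "\<dots> \<le> (\<Sum>W\<in>\<F>. ennreal \<bar>K q\<bar> * indicator (W \<inter> ?I) q)"
      using W(1) \<F>(1) by (intro member_le_sum) auto
    finally show "ennreal (norm (K q)) \<le> (\<Sum>W\<in>\<F>. ennreal \<bar>K q\<bar> * indicator (W \<inter> ?I) q)" .
  qed
  also have "\<dots> = (\<Sum>W\<in>\<F>. \<integral>\<^sup>+q\<in>W \<inter> ?I. ennreal \<bar>K q\<bar> \<partial>dS)"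
  proof (rule nn_integral_sum)
    fix W assume "W \<in> \<F>"
    then have "W \<inter> ?I \<in> sets dS" using \<F>(2) by (auto simp: good_def)
    then show "(\<lambda>q. ennreal \<bar>K q\<bar> * indicator (W \<inter> ?I) q) \<in> borel_measurable dS"
      using meas by measurable
  qed
  also have "\<dots> < \<infinity>"
    using \<F>(1,2) by (auto simp: good_def)
  finally show ?thesis using meas by (intro integrableI_bounded)
qed

end
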